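(* For any sequence $(a_n)_{n\ge1}$ of nonnegative real numbers with $a_n\to 0$, there exist a stationary ergodic discrete Markov chain $(Y_k)_{k\ge 0}$ and a real-valued function $g$ on its state space such that, setting $X_i=g(Y_i)$ for $i\ge 0$ and $S_n=\sum_{i=1}^n X_i$, one has $E[X_1]=0$, $E[X_1^2]<\infty$ and $$\sum_{n=1}^{\infty}a_n\frac{\|E(S_n\mid Y_0)\|}{n^{3/2}}<\infty ,$$ but the sequence $\{S_n/\sqrt{n}: n\ge 1\}$ is not stochastically bounded.
   Context: Notation: $\|X\|=\sqrt{E(X^2)}$. A discrete Markov chain is one with countable state space. A sequence of random variables $(Z_n)$ is stochastically bounded (tight) if $\lim_{M\to\infty}\sup_n P(|Z_n|>M)=0$. *)

theory Defs
  imports "HOL-Probability.Probability"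
begin

locale discrete_markov_chain = prob_space M
  for M :: "'w measure" and S :: "'s set" and Y :: "nat \<Rightarrow> 'w \<Rightarrow> 's" +
  assumes countable_states: "countable S"
    and random_variable_Y: "\<And>k. Y k \<in> measurable M (count_space S)"
    and markov_property:
      "\<And>n s. \<P>(\<omega> in M. \<forall>k\<le>n. Y k \<omega> = s k) > 0 \<Longrightarrow>
        \<P>(\<omega> in M. Y (Suc n) \<omega> = s (Suc n) \<bar> \<forall>k\<le>n. Y k \<omega> = s k) =
        \<P>(\<omega> in M. Y (Suc n) \<omega> = s (Suc n) \<bar> Y n \<omega> = s n)"

definition stationary_process :: "'w measure \<Rightarrow> 's measure \<Rightarrow> (nat \<Rightarrow> 'w \<Rightarrow> 's) \<Rightarrow> bool" where
  "stationary_process M N Y \<longleftrightarrow>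
     distr M (Pi\<^sub>M UNIV (\<lambda>_. N)) (\<lambda>\<omega> k. Y (Suc k) \<omega>) =
     distr M (Pi\<^sub>M UNIV (\<lambda>_. N)) (\<lambda>\<omega> k. Y k \<omega>)"

text \<open>Ergodicity of the left shift with respect to the law of the process on path space.\<close>

definition ergodic_process :: "'w measure \<Rightarrow> 's measure \<Rightarrow> (nat \<Rightarrow> 'w \<Rightarrow> 's) \<Rightarrow> bool" where
  "ergodic_process M N Y \<longleftrightarrow>
     (\<forall>A \<in> sets (Pi\<^sub>M UNIV (\<lambda>_. N)).
        {x \<in> space (Pi\<^sub>M UNIV (\<lambda>_. N)). (\<lambda>k. x (Suc k)) \<in> A} = A \<longrightarrow>
        \<P>(\<omega> in M. (\<lambda>k. Y k \<omega>) \<in> A) \<in> {0, 1})"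

definition stationary_ergodic_markov_chain ::
    "'w measure \<Rightarrow> 's set \<Rightarrow> (nat \<Rightarrow> 'w \<Rightarrow> 's) \<Rightarrow> bool" where
  "stationary_ergodic_markov_chain M S Y \<longleftrightarrow>
     discrete_markov_chain M S Y \<and>
     stationary_process M (count_space S) Y \<and>
     ergodic_process M (count_space S) Y"

definition norm_L2 :: "'w measure \<Rightarrow> ('w \<Rightarrow> real) \<Rightarrow> real" where
  "norm_L2 M X = sqrt (\<integral>\<omega>. (X \<omega>)\<^sup>2 \<partial>M)"

definition cond_exp_given ::
    "'w measure \<Rightarrow> 's measure \<Rightarrow> ('w \<Rightarrow> 's) \<Rightarrow> ('w \<Rightarrow> real) \<Rightarrow> 'w \<Rightarrow> real" where
  "cond_exp_given M N V X = real_cond_exp M (vimage_algebra (space M) V N) X"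

definition stochastically_bounded ::
    "'w measure \<Rightarrow> nat set \<Rightarrow> (nat \<Rightarrow> 'w \<Rightarrow> real) \<Rightarrow> bool" where
  "stochastically_bounded M I Z \<longleftrightarrow>
     ((\<lambda>K::real. SUP n\<in>I. \<P>(\<omega> in M. \<bar>Z n \<omega>\<bar> > K)) \<longlongrightarrow> 0) at_top"

end

theory Submission
  imports Defs
begin

text \<open>
The state space is \<open>\<nat>\<close>, read as pairs of a sign (the parity of \<open>y\<close>) and a remaining lifetime (\<open>y div 2\<close>).
The lifetime decreases by one at each step; when it is used up, an independent innovation supplies the length and
the sign of the next block, the sign being symmetric. With \<open>g\<close> equal to the sign, \<open>S\<^sub>n\<close> is a sum of
block lengths with independent symmetric signs, the blocks at the two ends being truncated.

The symmetry trivialises the conditional expectation: given \<open>Y\<^sub>0\<close>, everything after the current block has mean zero,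
so \<open>E(S\<^sub>n | Y\<^sub>0)\<close> is the sign of \<open>Y\<^sub>0\<close> times \<open>min n (Y\<^sub>0 div 2)\<close> (lemma \<open>cond_exp_spin_sum\<close>).
It comes from the reflection that reverses the signs of all later blocks and preserves the measure.

Block length \<open>L\<^sub>k\<close> is drawn with probability proportional to \<open>4\<^sup>k / L\<^sub>k\<^sup>2\<close>. The mean length is finite, and the stationary
state lies in a block of length \<open>L\<^sub>k\<close> with probability \<open>q\<^sub>k\<close> proportional to \<open>4\<^sup>k / L\<^sub>k\<close>. Hence \<open>\<parallel>E(S\<^sub>n | Y\<^sub>0)\<parallel>\<close> is at most
the sum over \<open>k\<close> of \<open>sqrt q\<^sub>k * min n L\<^sub>k\<close>. The sum over \<open>n\<close> of \<open>min n L / n powr (3/2)\<close> has order \<open>sqrt L\<close>, and the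
weights \<open>a\<^sub>n\<close>, which tend to zero, improve this to \<open>o(sqrt L)\<close> (lemma \<open>weighted_sum_min_over_powr_small\<close>). If the
\<open>L\<^sub>k\<close> grow fast enough, depending on \<open>a\<close>, the block length \<open>L\<^sub>k\<close> contributes at most a constant times \<open>2\<^sup>-\<^sup>k\<close> to the
series, which therefore converges.

On the other hand, within a number of steps of order \<open>L\<^sub>k\<^sup>2 / 4\<^sup>k\<close> some block of length \<open>L\<^sub>k\<close> starts with probability
bounded below. Reversing the sign of that one block changes \<open>S\<^sub>n\<close> by \<open>2 L\<^sub>k\<close>, so \<open>\<bar>S\<^sub>n\<bar> \<ge> L\<^sub>k\<close> holds with at
least half that probability (lemma \<open>prob_large_spin_sum\<close>). Since \<open>L\<^sub>k\<close> is at least of order \<open>2\<^sup>k sqrt n\<close>, the sequence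
\<open>S\<^sub>n / sqrt n\<close> is not tight.
\<close>

section \<open>Signed blocks driven by innovations\<close>

text \<open>The parity of a state is the sign of the current block and \<open>y div 2\<close> the number of steps it still lasts,
so a descent by two keeps the sign and \<open>y < 2\<close> is the last instant of a block.\<close>

definition step :: "nat \<Rightarrow> nat \<Rightarrow> nat" where
  "step y t = (if y < 2 then t else y - 2)"

primrec chain :: "nat \<Rightarrow> (nat \<Rightarrow> nat) \<Rightarrow> nat" where
  "chain 0 \<omega> = \<omega> 0"
| "chain (Suc k) \<omega> = step (chain k \<omega>) (\<omega> (Suc k))"

definition flip :: "nat \<Rightarrow> nat" where
  "flip y = (if even y then Suc y else y - 1)"

definition spin :: "nat \<Rightarrow> real" where
  "spin y = (if even y then 1 else -1)"

definition flip_on :: "nat set \<Rightarrow> (nat \<Rightarrow> nat) \<Rightarrow> nat \<Rightarrow> nat" where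
  "flip_on I \<omega> = (\<lambda>i. if i \<in> I then flip (\<omega> i) else \<omega> i)"

definition spin_sum :: "nat \<Rightarrow> (nat \<Rightarrow> nat) \<Rightarrow> real" where
  "spin_sum n \<omega> = (\<Sum>i=1..n. spin (chain i \<omega>))"

lemma flip_div_2 [simp]: "flip y div 2 = y div 2"
  by (auto simp: flip_def elim!: oddE)

lemma flip_flip [simp]: "flip (flip y) = y"
  by (auto simp: flip_def elim!: oddE)

lemma spin_flip [simp]: "spin (flip y) = - spin y"
  by (auto simp: flip_def spin_def)

lemma spin_minus_even: "2 * j \<le> y \<Longrightarrow> spin (y - 2 * j) = spin y"
  by (auto simp: spin_def)

lemma abs_spin [simp]: "\<bar>spin y\<bar> = 1"
  by (auto simp: spin_def)

lemma step_flip: "step (flip y) (flip t) = flip (step y t)"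
  by (auto simp: step_def flip_def elim!: oddE)

lemma chain_cong: "(\<And>i. i \<le> k \<Longrightarrow> \<omega> i = \<omega>' i) \<Longrightarrow> chain k \<omega> = chain k \<omega>'"
  by (induction k) auto

lemma chain_descent: "j \<le> chain k \<omega> div 2 \<Longrightarrow> chain (k + j) \<omega> = chain k \<omega> - 2 * j"
  by (induction j) (auto simp: step_def)

text \<open>The end of a block is a renewal: from there on the chain no longer depends on the earlier innovations.\<close>

lemma chain_restart:
  "chain k \<omega> < 2 \<Longrightarrow> chain (Suc k + j) \<omega> = chain j (\<lambda>i. \<omega> (Suc k + i))"
  by (induction j) (auto simp: step_def)

lemma chain_all_flipped: "chain j (\<lambda>i. flip (\<omega> i)) = flip (chain j \<omega>)"
  by (induction j) (auto simp: step_flip)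

text \<open>A step commutes with \<open>flip\<close>, and at a renewal the past is forgotten; so two innovation sequences that are mirror
images from a common renewal time on have mirror-image chains, even if their states at that time agree.\<close>

lemma chain_flip_after:
  assumes "chain k \<omega> < 2" "chain k \<omega>' < 2" "\<And>i. i > k \<Longrightarrow> \<omega>' i = flip (\<omega> i)" "j > k"
  shows "chain j \<omega>' = flip (chain j \<omega>)"
proof -
  obtain d where "j = Suc k + d"
    using less_iff_Suc_add[of k j] \<open>j > k\<close> by auto
  moreover have "(\<lambda>i. \<omega>' (Suc k + i)) = (\<lambda>i. flip (\<omega> (Suc k + i)))"
    using assms(3) by auto
  ultimately show ?thesis
    by (simp only: chain_restart[OF assms(1)] chain_restart[OF assms(2)] chain_all_flipped)
qed

lemma chain_eq_after:
  assumes "chain k \<omega> < 2" "chain k \<omega>' < 2" "\<And>i. i > k \<Longrightarrow> \<omega>' i = \<omega> i" "j > k"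
  shows "chain j \<omega>' = chain j \<omega>"
proof -
  obtain d where "j = Suc k + d"
    using less_iff_Suc_add[of k j] \<open>j > k\<close> by auto
  moreover have "(\<lambda>i. \<omega>' (Suc k + i)) = (\<lambda>i. \<omega> (Suc k + i))"
    using assms(3) by auto
  ultimately show ?thesis
    by (simp only: chain_restart[OF assms(1)] chain_restart[OF assms(2)])
qed

lemma chain_block_end: "chain (k + chain k \<omega> div 2) \<omega> < 2"
  by (subst chain_descent) auto

lemma spin_chain_block:
  assumes "j \<le> chain k \<omega> div 2"
  shows "spin (chain (k + j) \<omega>) = spin (chain k \<omega>)"
  using assms by (simp add: chain_descent spin_minus_even)

text \<open>Reversing all innovations leaves the initial block alone and mirrors the rest, so that in the sum of the two
partial sums only the initial block survives.\<close>

lemma spin_sum_flip_future: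
  "spin_sum n \<omega> + spin_sum n (flip_on {1..} \<omega>) = 2 * spin (\<omega> 0) * real (min n (\<omega> 0 div 2))"
proof -
  let ?r = "\<omega> 0 div 2" and ?\<omega>' = "flip_on {1..} \<omega>"
  have 0: "?\<omega>' 0 = \<omega> 0"
    by (simp add: flip_on_def)
  have "spin (chain i \<omega>) + spin (chain i ?\<omega>') = (if i \<le> ?r then 2 * spin (\<omega> 0) else 0)"
    if "i \<ge> 1" for i
  proof (cases "i \<le> ?r")
    case True
    then show ?thesis
      using spin_chain_block[of i 0 \<omega>] spin_chain_block[of i 0 ?\<omega>'] 0 by simp
  next
    case False
    have "chain i ?\<omega>' = flip (chain i \<omega>)"
      using False chain_block_end[of 0 \<omega>] chain_block_end[of 0 ?\<omega>'] 0
      by (intro chain_flip_after[of ?r]) (auto simp: flip_on_def)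
    with False show ?thesis by simp
  qed
  then have "spin_sum n \<omega> + spin_sum n ?\<omega>' = (\<Sum>i=1..n. if i \<le> ?r then 2 * spin (\<omega> 0) else 0)"
    unfolding spin_sum_def sum.distrib[symmetric] by (intro sum.cong) auto
  also have "\<dots> = (\<Sum>i\<in>{1..min n ?r}. 2 * spin (\<omega> 0))"
    by (intro sum.mono_neutral_cong_right) auto
  finally show ?thesis by simp
qed

text \<open>A block started by the innovation \<open>\<omega> (Suc i)\<close> has length \<open>Suc r\<close>. It lies entirely in the summation range, and
reversing that innovation reverses this block and nothing else.\<close>

lemma spin_sum_flip_block:
  assumes "chain i \<omega> < 2" and r: "\<omega> (Suc i) div 2 = r" and "Suc i + r \<le> n"
  shows "\<bar>spin_sum n \<omega> - spin_sum n (flip_on {Suc i} \<omega>)\<bar> = 2 * real (Suc r)"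
proof -
  let ?\<omega>' = "flip_on {Suc i} \<omega>" and ?s = "spin (\<omega> (Suc i))"
  have before: "chain j ?\<omega>' = chain j \<omega>" if "j \<le> i" for j
    using that by (intro chain_cong) (auto simp: flip_on_def)
  have start: "chain (Suc i) \<omega> = \<omega> (Suc i)" "chain (Suc i) ?\<omega>' = flip (\<omega> (Suc i))"
    using assms(1) before[of i] by (simp_all add: step_def flip_on_def)
  have "spin (chain j \<omega>) - spin (chain j ?\<omega>') = (if j \<in> {Suc i..Suc i + r} then 2 * ?s else 0)" for j
  proof -
    consider "j \<le> i" | d where "j = Suc i + d" "d \<le> r" | "j > Suc i + r"
      by (metis le_Suc_ex nat_le_linear not_less_eq_eq not_less add_le_cancel_left)
    then show ?thesis
    proof cases
      case 1
      then show ?thesis by (simp add: before)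
    next
      case 2
      then show ?thesis
        using spin_chain_block[of d "Suc i" \<omega>] spin_chain_block[of d "Suc i" ?\<omega>'] start r by simp
    next
      case 3
      have "chain j ?\<omega>' = chain j \<omega>"
      proof (rule chain_eq_after[of "Suc i + r"])
        show "chain (Suc i + r) \<omega> < 2"
          using chain_block_end[of "Suc i" \<omega>] by (simp only: start r)
        show "chain (Suc i + r) ?\<omega>' < 2"
          using chain_block_end[of "Suc i" ?\<omega>'] by (simp only: start r flip_div_2)
      qed (use 3 in \<open>auto simp: flip_on_def\<close>)
      with 3 show ?thesis by simp
    qed
  qed
  then have "spin_sum n \<omega> - spin_sum n ?\<omega>' = (\<Sum>j=1..n. if j \<in> {Suc i..Suc i + r} then 2 * ?s else 0)"
    unfolding spin_sum_def sum_subtractf[symmetric] by (intro sum.cong) auto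
  also have "\<dots> = (\<Sum>j\<in>{Suc i..Suc i + r}. 2 * ?s)"
    using assms(3) by (intro sum.mono_neutral_cong_right) auto
  finally show ?thesis
    by (simp add: abs_mult)
qed

section \<open>The product measure and its symmetries\<close>

text \<open>The equation \<open>balance\<close> is stationarity of \<open>\<pi>\<close>: a state is reached either by a renewal, which happens from the states
\<open>0\<close> and \<open>1\<close>, or by descent from \<open>y + 2\<close>.\<close>

locale block_chain =
  fixes \<pi> \<nu> :: "nat pmf"
  assumes balance: "pmf \<pi> y = (pmf \<pi> 0 + pmf \<pi> 1) * pmf \<nu> y + pmf \<pi> (y + 2)"
    and flip_invariant: "map_pmf flip \<pi> = \<pi>" "map_pmf flip \<nu> = \<nu>"
begin

definition law :: "nat \<Rightarrow> nat measure" where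
  "law i = measure_pmf (if i = 0 then \<pi> else \<nu>)"

definition P :: "(nat \<Rightarrow> nat) measure" where
  "P = Pi\<^sub>M UNIV law"

sublocale law: product_prob_space law UNIV
  by (rule product_prob_spaceI) (simp add: law_def measure_pmf.prob_space_axioms)

sublocale P: prob_space P
  unfolding P_def by (rule law.P.prob_space_axioms)

lemma sets_law [simp, measurable_cong]: "sets (law i) = sets (count_space UNIV)"
  by (simp add: law_def)

lemma space_law [simp]: "space (law i) = UNIV"
  by (simp add: law_def)

lemma sets_P: "sets P = sets (Pi\<^sub>M UNIV (\<lambda>_. count_space UNIV))"
  unfolding P_def by (intro sets_PiM_cong) auto

lemma space_P [simp]: "space P = UNIV"
  by (simp add: P_def space_PiM)

lemma measurable_coordinate [measurable]: "(\<lambda>\<omega>. \<omega> i) \<in> P \<rightarrow>\<^sub>M count_space UNIV"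
  unfolding measurable_cong_sets[OF sets_P refl] by measurable

lemma measurable_P:
  assumes "\<And>i. (\<lambda>x. f x i) \<in> X \<rightarrow>\<^sub>M count_space UNIV"
  shows "f \<in> X \<rightarrow>\<^sub>M P"
  unfolding measurable_cong_sets[OF refl sets_P]
  using assms by (intro measurable_PiM_single') auto

lemma cylinder_eq: "prod_emb UNIV law J (Pi\<^sub>E J F) = {\<omega>. \<forall>j\<in>J. \<omega> j \<in> F j}"
  by (auto simp: prod_emb_def space_PiM PiE_iff)

lemma sets_cylinder [measurable]: "finite J \<Longrightarrow> {\<omega>. \<forall>j\<in>J. \<omega> j \<in> F j} \<in> sets P"
  by (simp add: P_def cylinder_eq[symmetric] sets_PiM_I)

lemma emeasure_cylinder:
  assumes "finite J"
  shows "emeasure P {\<omega>. \<forall>j\<in>J. \<omega> j \<in> F j} = (\<Prod>j\<in>J. emeasure (law j) (F j))"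
  unfolding P_def cylinder_eq[symmetric] using assms by (intro law.emeasure_PiM_emb) auto

lemma distr_eq_P:
  assumes T: "T \<in> X \<rightarrow>\<^sub>M P"
    and "\<And>J F. finite J \<Longrightarrow>
      emeasure X {x \<in> space X. \<forall>j\<in>J. T x j \<in> F j} = (\<Prod>j\<in>J. emeasure (law j) (F j))"
  shows "distr X P T = P"
  unfolding P_def
proof (rule law.PiM_eq)
  fix J :: "nat set" and F :: "nat \<Rightarrow> nat set" assume J: "finite J"
  have "emeasure (distr X P T) {\<omega>. \<forall>j\<in>J. \<omega> j \<in> F j} = emeasure X {x \<in> space X. \<forall>j\<in>J. T x j \<in> F j}"
    using T sets_cylinder[OF J] by (subst emeasure_distr) (auto intro!: arg_cong2[where f=emeasure])
  then show "emeasure (distr X (Pi\<^sub>M UNIV law) T) (prod_emb UNIV law J (Pi\<^sub>E J F)) = (\<Prod>j\<in>J. emeasure (law j) (F j))"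
    unfolding cylinder_eq P_def[symmetric] using assms(2)[OF J] by simp
qed simp

definition splice :: "nat set \<Rightarrow> (nat \<Rightarrow> nat) \<times> (nat \<Rightarrow> nat) \<Rightarrow> nat \<Rightarrow> nat" where
  "splice I = (\<lambda>(\<omega>, \<omega>') i. if i \<in> I then \<omega> i else \<omega>' i)"

lemma measurable_splice [measurable]: "splice I \<in> P \<Otimes>\<^sub>M P \<rightarrow>\<^sub>M P"
  by (intro measurable_P) (simp add: splice_def case_prod_beta)

text \<open>Coordinates in and outside \<open>I\<close> may be taken from two independent copies. This form of independence of the
coordinates reduces every independence statement below to a computation with product sets or to Fubini.\<close>

lemma distr_splice: "distr (P \<Otimes>\<^sub>M P) P (splice I) = P"
proof (rule distr_eq_P)
  fix J :: "nat set" and F :: "nat \<Rightarrow> nat set" assume J: "finite J"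
  have "{x \<in> space (P \<Otimes>\<^sub>M P). \<forall>j\<in>J. splice I x j \<in> F j} =
        {\<omega>. \<forall>j\<in>J \<inter> I. \<omega> j \<in> F j} \<times> {\<omega>. \<forall>j\<in>J - I. \<omega> j \<in> F j}"
    by (auto simp: splice_def space_pair_measure)
  then have "emeasure (P \<Otimes>\<^sub>M P) {x \<in> space (P \<Otimes>\<^sub>M P). \<forall>j\<in>J. splice I x j \<in> F j} =
      (\<Prod>j\<in>J \<inter> I. emeasure (law j) (F j)) * (\<Prod>j\<in>J - I. emeasure (law j) (F j))"
    using J by (simp add: P.emeasure_pair_measure_Times sets_cylinder emeasure_cylinder)
  also have "\<dots> = (\<Prod>j\<in>J. emeasure (law j) (F j))"
    using J by (subst prod.union_disjoint[symmetric]) (auto intro!: prod.cong)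
  finally show "emeasure (P \<Otimes>\<^sub>M P) {x \<in> space (P \<Otimes>\<^sub>M P). \<forall>j\<in>J. splice I x j \<in> F j} = (\<Prod>j\<in>J. emeasure (law j) (F j))" .
qed measurable

lemma emeasure_indep_coordinates:
  assumes A: "A \<in> sets P" and B: "B \<in> sets P"
    and AI: "\<And>\<omega> \<omega>'. (\<And>i. i \<in> I \<Longrightarrow> \<omega> i = \<omega>' i) \<Longrightarrow> \<omega> \<in> A \<longleftrightarrow> \<omega>' \<in> A"
    and BI: "\<And>\<omega> \<omega>'. (\<And>i. i \<notin> I \<Longrightarrow> \<omega> i = \<omega>' i) \<Longrightarrow> \<omega> \<in> B \<longleftrightarrow> \<omega>' \<in> B"
  shows "emeasure P (A \<inter> B) = emeasure P A * emeasure P B"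
proof -
  have "emeasure P (A \<inter> B) = emeasure (distr (P \<Otimes>\<^sub>M P) P (splice I)) (A \<inter> B)"
    by (simp add: distr_splice)
  also have "\<dots> = emeasure (P \<Otimes>\<^sub>M P) (splice I -` (A \<inter> B) \<inter> space (P \<Otimes>\<^sub>M P))"
    using A B by (intro emeasure_distr) auto
  also have "splice I -` (A \<inter> B) \<inter> space (P \<Otimes>\<^sub>M P) = A \<times> B"
  proof -
    have "splice I (\<omega>, \<omega>') \<in> A \<longleftrightarrow> \<omega> \<in> A" "splice I (\<omega>, \<omega>') \<in> B \<longleftrightarrow> \<omega>' \<in> B" for \<omega> \<omega>'
      by (auto intro!: AI BI simp: splice_def)
    then show ?thesis
      by (auto simp: space_pair_measure)
  qed
  finally show ?thesis
    by (simp add: P.emeasure_pair_measure_Times A B)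
qed

lemma prob_indep_coordinates:
  assumes "A \<in> sets P" "B \<in> sets P"
    and "\<And>\<omega> \<omega>'. (\<And>i. i \<in> I \<Longrightarrow> \<omega> i = \<omega>' i) \<Longrightarrow> \<omega> \<in> A \<longleftrightarrow> \<omega>' \<in> A"
    and "\<And>\<omega> \<omega>'. (\<And>i. i \<notin> I \<Longrightarrow> \<omega> i = \<omega>' i) \<Longrightarrow> \<omega> \<in> B \<longleftrightarrow> \<omega>' \<in> B"
  shows "P.prob (A \<inter> B) = P.prob A * P.prob B"
  using emeasure_indep_coordinates[where I=I, OF assms] by (simp add: measure_def enn2real_mult)

lemma measurable_flip_on [measurable]: "flip_on I \<in> P \<rightarrow>\<^sub>M P"
  by (intro measurable_P) (simp add: flip_on_def)

text \<open>Both coordinate laws are invariant under \<open>flip\<close>, so reversing the signs of any set of innovations preserves the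
measure. All the symmetry arguments below are instances of this.\<close>

lemma distr_flip_on: "distr P P (flip_on I) = P"
proof (rule distr_eq_P)
  fix J :: "nat set" and F :: "nat \<Rightarrow> nat set" assume J: "finite J"
  have *: "emeasure (law j) (flip -` F j) = emeasure (law j) (F j)" for j
    using emeasure_map_pmf[of flip \<pi> "F j"] emeasure_map_pmf[of flip \<nu> "F j"]
    unfolding flip_invariant law_def by (cases "j = 0") simp_all
  have "{\<omega> \<in> space P. \<forall>j\<in>J. flip_on I \<omega> j \<in> F j} =
      {\<omega>. \<forall>j\<in>J. \<omega> j \<in> (if j \<in> I then flip -` F j else F j)}"
    by (auto simp: flip_on_def)
  then show "emeasure P {\<omega> \<in> space P. \<forall>j\<in>J. flip_on I \<omega> j \<in> F j} = (\<Prod>j\<in>J. emeasure (law j) (F j))"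
    using J by (simp only: emeasure_cylinder) (auto intro!: prod.cong simp: *)
qed measurable

lemma measurable_step [measurable (raw)]:
  assumes [measurable]: "f \<in> X \<rightarrow>\<^sub>M count_space UNIV" "g \<in> X \<rightarrow>\<^sub>M count_space UNIV"
  shows "(\<lambda>x. step (f x) (g x)) \<in> X \<rightarrow>\<^sub>M count_space UNIV"
  unfolding step_def by measurable

lemma measurable_chain [measurable]: "chain k \<in> P \<rightarrow>\<^sub>M count_space UNIV"
proof (induction k)
  case (Suc k)
  note [measurable] = Suc
  show ?case unfolding chain.simps by measurable
qed (simp add: measurable_coordinate)

lemma prob_initial: "P.prob {\<omega>. \<omega> 0 \<in> F} = measure_pmf.prob \<pi> F"
  using emeasure_cylinder[of "{0}" "\<lambda>_. F"] by (simp add: law_def measure_def)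

lemma prob_innovation: "i > 0 \<Longrightarrow> P.prob {\<omega>. \<omega> i \<in> F} = measure_pmf.prob \<nu> F"
  using emeasure_cylinder[of "{i}" "\<lambda>_. F"] by (simp add: law_def measure_def)

lemma sets_coordinate: "{\<omega>. \<omega> i \<in> F} \<in> sets P"
  using measurable_sets[OF measurable_coordinate, of F i] by (simp add: vimage_def)

lemma sets_chain: "{\<omega>. chain k \<omega> \<in> F} \<in> sets P"
  using measurable_sets[OF measurable_chain, of F k] by (simp add: vimage_def)

lemma distr_chain_1: "distr P (count_space UNIV) (chain 1) = measure_pmf \<pi>"
proof (rule measure_eqI_countable[where A=UNIV])
  fix y :: nat
  let ?A = "{\<omega> :: nat \<Rightarrow> nat. \<omega> 0 < 2}" and ?B = "{\<omega> :: nat \<Rightarrow> nat. \<omega> (Suc 0) = y}"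
    and ?C = "{\<omega> :: nat \<Rightarrow> nat. \<omega> 0 = Suc (Suc y)}"
  have [measurable]: "?A \<in> sets P" "?B \<in> sets P" "?C \<in> sets P"
    using sets_coordinate[of 0 "{..<2}"] sets_coordinate[of "Suc 0" "{y}"] sets_coordinate[of 0 "{Suc (Suc y)}"]
    by simp_all
  have "chain 1 -` {y} \<inter> space P = (?A \<inter> ?B) \<union> ?C"
    by (auto simp: step_def split: if_splits)
  then have "emeasure (distr P (count_space UNIV) (chain 1)) {y} = P.prob ((?A \<inter> ?B) \<union> ?C)"
    by (simp add: emeasure_distr P.emeasure_eq_measure)
  also have "P.prob ((?A \<inter> ?B) \<union> ?C) = P.prob (?A \<inter> ?B) + P.prob ?C"
    by (intro P.finite_measure_Union) auto
  also have "P.prob (?A \<inter> ?B) = P.prob ?A * P.prob ?B"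
    by (rule prob_indep_coordinates[where I="{0}"]) auto
  also have "P.prob ?A = pmf \<pi> 0 + pmf \<pi> 1"
  proof -
    have "P.prob ?A = measure_pmf.prob \<pi> {0, 1}"
      using prob_initial[of "{0,1}"] by (simp add: less_2_cases_iff)
    then show ?thesis
      by (subst (asm) measure_measure_pmf_finite) auto
  qed
  also have "P.prob ?B = pmf \<nu> y"
    using prob_innovation[of "Suc 0" "{y}"] by (simp add: pmf.rep_eq)
  also have "P.prob ?C = pmf \<pi> (Suc (Suc y))"
    using prob_initial[of "{Suc (Suc y)}"] by (simp add: pmf.rep_eq)
  also have "(pmf \<pi> 0 + pmf \<pi> 1) * pmf \<nu> y + pmf \<pi> (Suc (Suc y)) = pmf \<pi> y"
    using balance[of y] by simp
  finally show "emeasure (distr P (count_space UNIV) (chain 1)) {y} = emeasure (measure_pmf \<pi>) {y}"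
    by (simp only: emeasure_pmf_single)
qed auto

text \<open>The shift of the chain is not the shift of the innovations: after one step the new initial state is \<open>chain 1\<close>, and the
innovation used for it must be dropped.\<close>

definition advance :: "(nat \<Rightarrow> nat) \<Rightarrow> nat \<Rightarrow> nat" where
  "advance \<omega> = (\<lambda>i. if i = 0 then chain 1 \<omega> else \<omega> (Suc i))"

lemma measurable_advance [measurable]: "advance \<in> P \<rightarrow>\<^sub>M P"
  unfolding advance_def by (intro measurable_P) measurable

lemma chain_advance: "chain k (advance \<omega>) = chain (Suc k) \<omega>"
  by (induction k) (auto simp: advance_def)

text \<open>The new initial state depends on the first two coordinates only and has law \<open>\<pi>\<close>; the remaining
innovations are untouched. Stationarity of the whole trajectory follows.\<close>

lemma distr_advance: "distr P P advance = P"
proof (rule distr_eq_P)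
  fix J :: "nat set" and F :: "nat \<Rightarrow> nat set" assume J: "finite J"
  let ?F0 = "if 0 \<in> J then F 0 else UNIV" and ?J = "J - {0}"
  let ?A = "{\<omega>. chain 1 \<omega> \<in> ?F0}" and ?B = "{\<omega>. \<forall>j\<in>Suc ` ?J. \<omega> j \<in> F (j - 1)}"
  have A: "?A \<in> sets P"
    by (rule sets_chain)
  have B: "?B \<in> sets P"
    using J by (intro sets_cylinder) auto
  have "{\<omega> \<in> space P. \<forall>j\<in>J. advance \<omega> j \<in> F j} = ?A \<inter> ?B"
    by (auto simp: advance_def split: if_splits)
  then have "emeasure P {\<omega> \<in> space P. \<forall>j\<in>J. advance \<omega> j \<in> F j} = emeasure P (?A \<inter> ?B)"
    by simp
  also have "\<dots> = emeasure P ?A * emeasure P ?B"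
    using A B by (rule emeasure_indep_coordinates[where I="{0, 1}"]) auto
  also have "emeasure P ?A = emeasure \<pi> ?F0"
    by (subst distr_chain_1[symmetric], subst emeasure_distr) (auto intro!: arg_cong2[where f=emeasure])
  also have "emeasure P ?B = (\<Prod>j\<in>Suc ` ?J. emeasure (law j) (F (j - 1)))"
    using J by (intro emeasure_cylinder) auto
  also have "\<dots> = (\<Prod>j\<in>?J. emeasure (law j) (F j))"
    by (subst prod.reindex) (auto simp: law_def intro!: prod.cong)
  also have "emeasure \<pi> ?F0 * \<dots> = (\<Prod>j\<in>J. emeasure (law j) (F j))"
  proof (cases "0 \<in> J")
    case True
    then show ?thesis
      using J by (simp add: prod.remove[of J 0] law_def)
  next
    case False
    then show ?thesis
      by (simp add: measure_pmf.emeasure_space_1[simplified])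
  qed
  finally show "emeasure P {\<omega> \<in> space P. \<forall>j\<in>J. advance \<omega> j \<in> F j} = (\<Prod>j\<in>J. emeasure (law j) (F j))" .
qed measurable

section \<open>Markov property, stationarity and ergodicity\<close>

text \<open>The next state is a function of the present one and of an innovation that is independent of the past. This covers both
conditional probabilities in the Markov property, with the event \<open>D\<close> describing the whole past or only the present.\<close>

lemma prob_chain_Suc:
  assumes D: "D \<in> sets P"
    and past: "\<And>\<omega> \<omega>'. (\<And>i. i \<le> n \<Longrightarrow> \<omega> i = \<omega>' i) \<Longrightarrow> \<omega> \<in> D \<longleftrightarrow> \<omega>' \<in> D"
    and now: "D \<subseteq> {\<omega>. chain n \<omega> = y}"
  shows "P.prob ({\<omega>. chain (Suc n) \<omega> = z} \<inter> D) = measure_pmf.prob \<nu> {t. step y t = z} * P.prob D"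
proof -
  let ?B = "{\<omega>. \<omega> (Suc n) \<in> {t. step y t = z}}"
  have "{\<omega>. chain (Suc n) \<omega> = z} \<inter> D = D \<inter> ?B"
    using now by auto
  also have "P.prob (D \<inter> ?B) = P.prob D * P.prob ?B"
  proof (rule prob_indep_coordinates[where I="{..n}", OF D sets_coordinate])
    show "\<omega> \<in> D \<longleftrightarrow> \<omega>' \<in> D" if "\<And>i. i \<in> {..n} \<Longrightarrow> \<omega> i = \<omega>' i" for \<omega> \<omega>'
      using that by (intro past) auto
  qed auto
  also have "P.prob ?B = measure_pmf.prob \<nu> {t. step y t = z}"
    by (rule prob_innovation) simp
  finally show ?thesis
    by (simp add: mult.commute)
qed

lemma discrete_markov_chain_chain: "discrete_markov_chain P UNIV chain"
proof
  fix n :: nat and s :: "nat \<Rightarrow> nat"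
  let ?D = "{\<omega>. \<forall>k\<le>n. chain k \<omega> = s k}" and ?E = "{\<omega>. chain n \<omega> = s n}"
  let ?F = "{\<omega>. chain (Suc n) \<omega> = s (Suc n)}" and ?p = "measure_pmf.prob \<nu> {t. step (s n) t = s (Suc n)}"
  assume "\<P>(\<omega> in P. \<forall>k\<le>n. chain k \<omega> = s k) > 0"
  then have pos: "P.prob ?D > 0"
    by simp
  have E: "?E \<in> sets P" and D: "?D \<in> sets P"
  proof -
    have *: "{\<omega>. chain k \<omega> = s k} \<in> sets P" for k
      using sets_chain[of k "{s k}"] by simp
    then show "?E \<in> sets P" .
    have "?D = (\<Inter>k\<in>{..n}. {\<omega>. chain k \<omega> = s k})"
      by auto
    also have "\<dots> \<in> sets P"
      using * by (intro sets.finite_INT) auto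
    finally show "?D \<in> sets P" .
  qed
  have "P.prob (?F \<inter> ?D) = ?p * P.prob ?D"
  proof (rule prob_chain_Suc[OF D])
    fix \<omega> \<omega>' :: "nat \<Rightarrow> nat"
    assume "\<And>i. i \<le> n \<Longrightarrow> \<omega> i = \<omega>' i"
    then have "chain k \<omega> = chain k \<omega>'" if "k \<le> n" for k
      using that by (intro chain_cong) auto
    then show "\<omega> \<in> ?D \<longleftrightarrow> \<omega>' \<in> ?D"
      by auto
  qed auto
  moreover have "P.prob (?F \<inter> ?E) = ?p * P.prob ?E"
  proof (rule prob_chain_Suc[OF E])
    fix \<omega> \<omega>' :: "nat \<Rightarrow> nat"
    assume "\<And>i. i \<le> n \<Longrightarrow> \<omega> i = \<omega>' i"
    then have "chain n \<omega> = chain n \<omega>'"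
      by (intro chain_cong)
    then show "\<omega> \<in> ?E \<longleftrightarrow> \<omega>' \<in> ?E"
      by auto
  qed auto
  moreover have "P.prob ?E > 0"
    using pos P.finite_measure_mono[OF _ E, of ?D] by force
  ultimately show "\<P>(\<omega> in P. chain (Suc n) \<omega> = s (Suc n) \<bar> \<forall>k\<le>n. chain k \<omega> = s k) =
        \<P>(\<omega> in P. chain (Suc n) \<omega> = s (Suc n) \<bar> chain n \<omega> = s n)"
    using pos unfolding cond_prob_def by (simp add: Int_def conj_commute del: chain.simps)
qed (auto simp: measurable_chain)

abbreviation trajectories :: "(nat \<Rightarrow> nat) measure" where
  "trajectories \<equiv> Pi\<^sub>M UNIV (\<lambda>_. count_space UNIV)"

lemma measurable_trajectory [measurable]: "(\<lambda>\<omega> k. chain k \<omega>) \<in> P \<rightarrow>\<^sub>M trajectories"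
  by (rule measurable_PiM_single') (auto simp: measurable_chain)

lemma stationary_chain: "stationary_process P (count_space UNIV) chain"
proof -
  have "distr P trajectories (\<lambda>\<omega> k. chain (Suc k) \<omega>) =
      distr P trajectories ((\<lambda>\<omega> k. chain k \<omega>) \<circ> advance)"
    by (simp add: comp_def chain_advance del: chain.simps)
  also have "\<dots> = distr (distr P P advance) trajectories (\<lambda>\<omega> k. chain k \<omega>)"
    by (rule distr_distr[symmetric]; measurable)
  finally show ?thesis
    by (simp add: stationary_process_def distr_advance)
qed

text \<open>The innovations after time \<open>0\<close> are identically distributed, whereas the initial state has another law; hence the
restriction to \<open>m > 0\<close>.\<close>

lemma emeasure_future:
  assumes "B \<in> sets trajectories" "m > 0"
  shows "emeasure P {\<omega>. (\<lambda>j. chain j (\<lambda>i. \<omega> (m + i))) \<in> B} =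
    emeasure P {\<omega>. (\<lambda>j. chain j (\<lambda>i. \<omega> (Suc i))) \<in> B}"
proof -
  let ?Q = "Pi\<^sub>M UNIV (\<lambda>_. measure_pmf \<nu>)"
  have shift: "distr P ?Q (\<lambda>\<omega> i. \<omega> (m + i)) = ?Q" if "m > 0" for m
    using distr_PiM_reindex[of UNIV law "\<lambda>i. m + i" UNIV] that
    by (simp add: law.prob_space P_def law_def measure_pmf.prob_space_axioms restrict_def)
  have sets_Q: "sets ?Q = sets P"
    unfolding sets_P by (intro sets_PiM_cong) auto
  have shift_meas: "(\<lambda>\<omega> i. \<omega> (m + i)) \<in> P \<rightarrow>\<^sub>M ?Q" for m
    unfolding measurable_cong_sets[OF refl sets_Q] by (intro measurable_P) measurable
  have "{\<omega>. (\<lambda>j. chain j \<omega>) \<in> B} \<in> sets P"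
    using measurable_sets[OF measurable_trajectory assms(1)] by (simp add: vimage_def)
  then have "emeasure P {\<omega>. (\<lambda>j. chain j (\<lambda>i. \<omega> (m + i))) \<in> B} = emeasure ?Q {\<omega>. (\<lambda>j. chain j \<omega>) \<in> B}"
    if "m > 0" for m
    by (subst shift[OF that, symmetric], subst emeasure_distr[OF shift_meas])
      (auto simp: sets_Q intro!: arg_cong2[where f=emeasure])
  from this[OF \<open>m > 0\<close>] this[of 1] show ?thesis
    by simp
qed

lemma shift_invariant_iff:
  assumes "{x :: nat \<Rightarrow> 's. (\<lambda>k. x (Suc k)) \<in> B} = B"
  shows "(\<lambda>k. x (m + k)) \<in> B \<longleftrightarrow> x \<in> B"
proof (induction m arbitrary: x)
  case (Suc m)
  have "x \<in> B \<longleftrightarrow> (\<lambda>k. x (Suc k)) \<in> B"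
    using assms by blast
  with Suc[of "\<lambda>k. x (Suc k)"] show ?case
    by simp
qed simp

text \<open>Given the coordinates up to \<open>n\<close>, the current block ends at a known time, after which the chain is driven by fresh
innovations. A shift-invariant event is decided by that part of the trajectory, so its conditional probability is a constant
that does not depend on the past.\<close>

lemma emeasure_past_and_invariant:
  assumes B: "B \<in> sets trajectories" "{x. (\<lambda>k. x (Suc k)) \<in> B} = B"
    and C: "C \<in> sets P" "\<And>\<omega> \<omega>'. (\<And>i. i \<le> n \<Longrightarrow> \<omega> i = \<omega>' i) \<Longrightarrow> \<omega> \<in> C \<longleftrightarrow> \<omega>' \<in> C"
  shows "emeasure P ({\<omega>. (\<lambda>k. chain k \<omega>) \<in> B} \<inter> C) =
    emeasure P {\<omega>. (\<lambda>j. chain j (\<lambda>i. \<omega> (Suc i))) \<in> B} * emeasure P C"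
proof -
  let ?A = "{\<omega>. (\<lambda>k. chain k \<omega>) \<in> B}" and ?S = "splice {..n}"
  let ?c = "emeasure P {\<omega>. (\<lambda>j. chain j (\<lambda>i. \<omega> (Suc i))) \<in> B}"
  have A: "?A \<in> sets P"
    using measurable_sets[OF measurable_trajectory B(1)] by (simp add: vimage_def)
  have spliced: "?S (\<omega>, \<omega>') \<in> ?A \<longleftrightarrow>
      (\<lambda>j. chain j (\<lambda>i. \<omega>' (Suc (n + chain n \<omega> div 2) + i))) \<in> B" for \<omega> \<omega>'
  proof -
    define k where "k = n + chain n \<omega> div 2"
    have "chain n (?S (\<omega>, \<omega>')) = chain n \<omega>"
      by (intro chain_cong) (auto simp: splice_def)
    then have "chain k (?S (\<omega>, \<omega>')) < 2"
      using chain_block_end[of n "?S (\<omega>, \<omega>')"] by (simp add: k_def)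
    then have "(\<lambda>j. chain (Suc k + j) (?S (\<omega>, \<omega>'))) = (\<lambda>j. chain j (\<lambda>i. ?S (\<omega>, \<omega>') (Suc k + i)))"
      by (simp only: chain_restart)
    also have "(\<lambda>i. ?S (\<omega>, \<omega>') (Suc k + i)) = (\<lambda>i. \<omega>' (Suc k + i))"
      by (auto simp: splice_def k_def)
    finally show ?thesis
      using shift_invariant_iff[OF B(2), of "\<lambda>j. chain j (?S (\<omega>, \<omega>'))" "Suc k"]
      by (simp add: k_def del: chain.simps add_Suc)
  qed
  have "emeasure P (?A \<inter> C) = emeasure (distr (P \<Otimes>\<^sub>M P) P ?S) (?A \<inter> C)"
    by (simp add: distr_splice)
  also have "\<dots> = emeasure (P \<Otimes>\<^sub>M P) (?S -` (?A \<inter> C) \<inter> space (P \<Otimes>\<^sub>M P))"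
    using A C by (intro emeasure_distr) auto
  also have "\<dots> = (\<integral>\<^sup>+\<omega>. emeasure P (Pair \<omega> -` (?S -` (?A \<inter> C) \<inter> space (P \<Otimes>\<^sub>M P))) \<partial>P)"
    using A C by (intro P.emeasure_pair_measure_alt measurable_sets[OF measurable_splice]) auto
  also have "\<dots> = (\<integral>\<^sup>+\<omega>. ?c * indicator C \<omega> \<partial>P)"
  proof (rule nn_integral_cong)
    fix \<omega>
    have C': "?S (\<omega>, \<omega>') \<in> C \<longleftrightarrow> \<omega> \<in> C" for \<omega>'
      by (rule C(2)) (auto simp: splice_def)
    have "Pair \<omega> -` (?S -` (?A \<inter> C) \<inter> space (P \<Otimes>\<^sub>M P)) = (if \<omega> \<in> C then
        {\<omega>'. (\<lambda>j. chain j (\<lambda>i. \<omega>' (Suc (n + chain n \<omega> div 2) + i))) \<in> B} else {})"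
      using C' spliced by (auto simp: space_pair_measure)
    also have "emeasure P \<dots> = ?c * indicator C \<omega>"
      using emeasure_future[OF B(1), of "Suc (n + chain n \<omega> div 2)"] by (auto simp del: chain.simps)
    finally show "emeasure P (Pair \<omega> -` (?S -` (?A \<inter> C) \<inter> space (P \<Otimes>\<^sub>M P))) = ?c * indicator C \<omega>" .
  qed
  finally show ?thesis
    using C(1) by (simp add: nn_integral_cmult)
qed

text \<open>By the previous lemma an invariant event \<open>A\<close> is independent of every cylinder. If \<open>A\<close> has positive probability,
conditioning on \<open>A\<close> therefore leaves the measure unchanged, and so \<open>A\<close> has probability one.\<close>

lemma ergodic_chain: "ergodic_process P (count_space UNIV) chain"
  unfolding ergodic_process_def
proof (intro ballI impI)
  fix B assume B: "B \<in> sets trajectories"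
    and "{x \<in> space trajectories. (\<lambda>k. x (Suc k)) \<in> B} = B"
  then have inv: "{x. (\<lambda>k. x (Suc k)) \<in> B} = B"
    by (simp add: space_PiM)
  let ?A = "{\<omega>. (\<lambda>k. chain k \<omega>) \<in> B}"
  let ?c = "emeasure P {\<omega>. (\<lambda>j. chain j (\<lambda>i. \<omega> (Suc i))) \<in> B}"
  have A: "?A \<in> sets P"
    using measurable_sets[OF measurable_trajectory B(1)] by (simp add: vimage_def)
  have c: "?c = emeasure P ?A"
    using emeasure_past_and_invariant[OF B inv, of UNIV] sets.top[of P] P.emeasure_space_1 by simp
  have "P.prob ?A = 1" if "emeasure P ?A \<noteq> 0"
  proof -
    have "uniform_measure P ?A = P"
      unfolding P_def
    proof (rule law.PiM_eq)
      fix J :: "nat set" and F :: "nat \<Rightarrow> nat set" assume J: "finite J"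
      let ?C = "{\<omega>. \<forall>j\<in>J. \<omega> j \<in> F j}"
      have "emeasure P (?A \<inter> ?C) = ?c * emeasure P ?C"
        using J by (intro emeasure_past_and_invariant[OF B inv sets_cylinder, of _ "Max J"]) auto
      then have "emeasure (uniform_measure P ?A) ?C = emeasure P ?C"
        using A sets_cylinder[OF J] that P.emeasure_finite
        by (simp add: c mult.commute[of "emeasure P ?A"] mult_divide_eq_ennreal)
      then show "emeasure (uniform_measure (Pi\<^sub>M UNIV law) ?A) (prod_emb UNIV law J (Pi\<^sub>E J F)) = (\<Prod>j\<in>J. emeasure (law j) (F j))"
        using emeasure_cylinder[OF J] by (simp add: cylinder_eq P_def)
    qed simp
    then have "emeasure P ?A = emeasure P (?A \<inter> ?A) / emeasure P ?A"
      using A by (metis emeasure_uniform_measure)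
    also have "\<dots> = 1"
      using that by (simp add: P.emeasure_eq_measure)
    finally show ?thesis
      by (simp add: P.emeasure_eq_measure)
  qed
  then show "\<P>(\<omega> in P. (\<lambda>k. chain k \<omega>) \<in> B) \<in> {0, 1}"
    by (cases "emeasure P ?A = 0") (auto simp: measure_def)
qed

lemma stationary_ergodic_chain: "stationary_ergodic_markov_chain P UNIV chain"
  unfolding stationary_ergodic_markov_chain_def
  using discrete_markov_chain_chain stationary_chain ergodic_chain by blast

section \<open>Conditional expectation of the partial sums\<close>

lemma distr_chain: "distr P (count_space UNIV) (chain k) = measure_pmf \<pi>"
proof (induction k)
  case 0
  have "distr P (count_space UNIV) (chain 0) = distr P (law 0) (\<lambda>\<omega>. \<omega> 0)"
    by (rule distr_cong) auto
  also have "\<dots> = law 0"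
    unfolding P_def by (rule law.PiM_component) simp
  also have "\<dots> = measure_pmf \<pi>"
    by (simp add: law_def)
  finally show ?case .
next
  case (Suc k)
  have "distr P (count_space UNIV) (chain (Suc k)) = distr P (count_space UNIV) (chain k \<circ> advance)"
    by (simp add: comp_def chain_advance del: chain.simps)
  also have "\<dots> = distr (distr P P advance) (count_space UNIV) (chain k)"
    by (rule distr_distr[symmetric]; measurable)
  finally show ?case
    by (simp only: distr_advance Suc)
qed

lemma prob_chain: "P.prob {\<omega>. chain k \<omega> \<in> F} = measure_pmf.prob \<pi> F"
  by (subst distr_chain[of k, symmetric], subst measure_distr) (auto intro!: arg_cong2[where f=measure] measurable_chain)

lemma measurable_spin_chain [measurable]: "(\<lambda>\<omega>. spin (chain k \<omega>)) \<in> borel_measurable P"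
  by (rule measurable_compose[OF measurable_chain]) simp

lemma measurable_spin_sum [measurable]: "spin_sum n \<in> borel_measurable P"
  unfolding spin_sum_def by measurable

lemma abs_spin_sum_le: "\<bar>spin_sum n \<omega>\<bar> \<le> real n"
  unfolding spin_sum_def using sum_abs[of "\<lambda>i. spin (chain i \<omega>)" "{1..n}"] by simp

lemma integrable_spin_sum: "integrable P (spin_sum n)"
  by (rule P.integrable_const_bound[of _ "real n"]) (auto simp: abs_spin_sum_le)

lemma integral_spin_chain: "(\<integral>\<omega>. spin (chain k \<omega>) \<partial>P) = 0"
proof -
  have "(\<integral>y. spin y \<partial>\<pi>) = (\<integral>y. spin y \<partial>map_pmf flip \<pi>)"
    by (simp only: flip_invariant)
  also have "\<dots> = - (\<integral>y. spin y \<partial>\<pi>)"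
    by (simp del: integral_map_pmf add: integral_map_pmf)
  finally have "(\<integral>y. spin y \<partial>\<pi>) = 0"
    by simp
  moreover have "(\<integral>\<omega>. spin (chain k \<omega>) \<partial>P) = (\<integral>y. spin y \<partial>distr P (count_space UNIV) (chain k))"
    by (rule integral_distr[symmetric]) (auto simp: measurable_chain)
  ultimately show ?thesis
    by (simp add: distr_chain)
qed

text \<open>An event \<open>A\<close> about \<open>\<omega> 0\<close> is invariant under the reversal of all innovations. Averaging the integral of \<open>S\<^sub>n\<close> over \<open>A\<close>
with its mirror image leaves the contribution of the initial block.\<close>

lemma cond_exp_spin_sum:
  "AE \<omega> in P. cond_exp_given P (count_space UNIV) (chain 0) (spin_sum n) \<omega>
     = spin (\<omega> 0) * real (min n (\<omega> 0 div 2))"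
proof -
  let ?F = "vimage_algebra (space P) (chain 0) (count_space UNIV)"
  let ?h = "\<lambda>\<omega>. spin (\<omega> 0) * real (min n (\<omega> 0 div 2))"
  have sub: "subalgebra P ?F"
    using measurable_sets[OF measurable_chain[of 0]] by (auto simp: subalgebra_def sets_vimage_algebra2)
  interpret F: finite_measure_subalgebra P ?F
    using sub by unfold_locales
  have h_meas: "?h \<in> borel_measurable ?F"
  proof -
    have "chain 0 \<in> ?F \<rightarrow>\<^sub>M count_space UNIV"
      by (rule measurable_vimage_algebra1) auto
    then have "(\<lambda>\<omega>. spin (chain 0 \<omega>) * real (min n (chain 0 \<omega> div 2))) \<in> borel_measurable ?F"
      by (rule measurable_compose) simp
    then show ?thesis by simp
  qed
  then have h_P [measurable]: "?h \<in> borel_measurable P"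
    by (rule measurable_from_subalg[OF sub])
  have h_int: "integrable P ?h"
    by (rule P.integrable_const_bound[of _ "real n"]) (auto simp: abs_mult)
  show ?thesis
    unfolding cond_exp_given_def
  proof (rule F.real_cond_exp_charact)
    fix A assume "A \<in> sets ?F"
    then obtain E where E: "A = {\<omega>. \<omega> 0 \<in> E}"
      by (auto simp: sets_vimage_algebra2 vimage_def)
    let ?T = "flip_on {1..}" and ?I = "indicator A :: (nat \<Rightarrow> nat) \<Rightarrow> real"
    have A [measurable]: "A \<in> sets P"
      unfolding E by (rule sets_coordinate)
    have inv: "indicator A (?T \<omega>) = ?I \<omega>" for \<omega>
      by (simp add: E flip_on_def indicator_def)
    have int: "integrable P (\<lambda>\<omega>. ?I \<omega> * spin_sum n \<omega>)"
      using integrable_real_mult_indicator[OF A integrable_spin_sum[of n]] by (simp add: mult.commute)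
    have "(\<integral>\<omega>. ?I \<omega> * spin_sum n \<omega> \<partial>P) = (\<integral>\<omega>. ?I \<omega> * spin_sum n \<omega> \<partial>distr P P ?T)"
      by (simp only: distr_flip_on)
    also have "\<dots> = (\<integral>\<omega>. ?I \<omega> * spin_sum n (?T \<omega>) \<partial>P)"
      by (subst integral_distr) (auto simp: inv simp del: One_nat_def)
    finally have eq: "(\<integral>\<omega>. ?I \<omega> * spin_sum n \<omega> \<partial>P) = (\<integral>\<omega>. ?I \<omega> * spin_sum n (?T \<omega>) \<partial>P)" .
    have "integrable (distr P P ?T) (\<lambda>\<omega>. ?I \<omega> * spin_sum n \<omega>)"
      using int by (simp only: distr_flip_on)
    then have int': "integrable P (\<lambda>\<omega>. ?I \<omega> * spin_sum n (?T \<omega>))"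
      by (subst (asm) integrable_distr_eq) (auto simp: inv simp del: One_nat_def)
    have "2 * (\<integral>\<omega>. ?I \<omega> * spin_sum n \<omega> \<partial>P) =
        (\<integral>\<omega>. ?I \<omega> * spin_sum n \<omega> + ?I \<omega> * spin_sum n (?T \<omega>) \<partial>P)"
      using int int' eq by simp
    also have "\<dots> = (\<integral>\<omega>. 2 * (?I \<omega> * ?h \<omega>) \<partial>P)"
      by (rule Bochner_Integration.integral_cong[OF refl])
        (use spin_sum_flip_future[of n] in \<open>simp add: distrib_left[symmetric] del: of_nat_min\<close>)
    also have "\<dots> = 2 * (\<integral>\<omega>. ?I \<omega> * ?h \<omega> \<partial>P)"
      by (rule integral_mult_right_zero)
    finally show "(\<integral>\<omega>\<in>A. spin_sum n \<omega> \<partial>P) = (\<integral>\<omega>\<in>A. ?h \<omega> \<partial>P)"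
      by (simp add: set_lebesgue_integral_def del: of_nat_min)
  qed (use integrable_spin_sum h_int h_meas in auto)
qed

lemma norm_cond_exp_spin_sum:
  "norm_L2 P (cond_exp_given P (count_space UNIV) (chain 0) (spin_sum n)) =
    sqrt (\<integral>y. (real (min n (y div 2)))\<^sup>2 \<partial>\<pi>)"
proof -
  let ?f = "\<lambda>y. (real (min n (y div 2)))\<^sup>2"
  have "(\<integral>\<omega>. (cond_exp_given P (count_space UNIV) (chain 0) (spin_sum n) \<omega>)\<^sup>2 \<partial>P) = (\<integral>\<omega>. ?f (chain 0 \<omega>) \<partial>P)"
  proof (rule integral_cong_AE)
    have sq: "(spin y * x)\<^sup>2 = x\<^sup>2" for y x
      by (simp add: spin_def)
    show "AE \<omega> in P. (cond_exp_given P (count_space UNIV) (chain 0) (spin_sum n) \<omega>)\<^sup>2 = ?f (chain 0 \<omega>)"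
      using cond_exp_spin_sum[of n] by eventually_elim (simp add: sq del: of_nat_min)
    show "(\<lambda>\<omega>. ?f (chain 0 \<omega>)) \<in> borel_measurable P"
      by (rule measurable_compose[OF measurable_chain]) simp
  qed (simp add: cond_exp_given_def)
  also have "\<dots> = (\<integral>y. ?f y \<partial>distr P (count_space UNIV) (chain 0))"
    by (rule integral_distr[symmetric]) (auto simp: measurable_chain)
  finally show ?thesis
    by (simp add: norm_L2_def distr_chain del: of_nat_min)
qed

section \<open>Lower bound for the probability of large partial sums\<close>

text \<open>This decomposes the event that a block of length \<open>Suc r\<close> starts by time \<open>m\<close>. Later innovations of the same type are
excluded whether or not the chain uses them: this makes the events disjoint for different \<open>i\<close> and, the coordinates being
independent, keeps their probabilities explicit.\<close>

lemma prob_last_block: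
  fixes r m i :: nat
  defines "p \<equiv> measure_pmf.prob \<nu> {t. t div 2 = r}"
  assumes "i < m"
  shows "P.prob ({\<omega>. chain i \<omega> < 2} \<inter> {\<omega>. \<omega> (Suc i) div 2 = r \<and> (\<forall>j\<in>{Suc (Suc i)..m}. \<omega> j div 2 \<noteq> r)})
    = measure_pmf.prob \<pi> {0, 1} * (p * (1 - p) ^ (m - Suc i))"
proof -
  let ?A = "{\<omega>. chain i \<omega> < 2}"
  let ?F = "\<lambda>j. {t. t div 2 = r \<longleftrightarrow> j = Suc i}" and ?J = "{Suc i..m}"
  let ?B = "{\<omega>. \<forall>j\<in>?J. \<omega> j \<in> ?F j}"
  have A: "?A \<in> sets P" "P.prob ?A = measure_pmf.prob \<pi> {0, 1}"
    using sets_chain[of i "{0, 1}"] prob_chain[of i "{0, 1}"] by (simp_all add: less_2_cases_iff)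
  have J: "?J = insert (Suc i) {Suc (Suc i)..m}"
    using \<open>i < m\<close> by auto
  have comp: "measure_pmf.prob \<nu> {t. t div 2 \<noteq> r} = 1 - p"
    using measure_pmf.prob_compl[of "{t. t div 2 = r}" \<nu>] by (simp add: p_def Compl_eq[symmetric] Compl_eq_Diff_UNIV[symmetric] Collect_neg_eq)
  have "emeasure P ?B = (\<Prod>j\<in>?J. ennreal (measure_pmf.prob \<nu> (?F j)))"
    by (subst emeasure_cylinder) (auto simp: law_def measure_pmf.emeasure_eq_measure intro!: prod.cong)
  then have "P.prob ?B = (\<Prod>j\<in>?J. measure_pmf.prob \<nu> (?F j))"
    by (simp add: measure_def prod_ennreal prod_nonneg)
  also have "\<dots> = p * (\<Prod>j\<in>{Suc (Suc i)..m}. 1 - p)"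
    unfolding J by (subst prod.insert) (auto simp: p_def[symmetric] comp intro!: prod.cong)
  finally have B: "P.prob ?B = p * (1 - p) ^ (m - Suc i)"
    by simp
  have "P.prob (?A \<inter> ?B) = P.prob ?A * P.prob ?B"
  proof (rule prob_indep_coordinates[where I="{..i}", OF A(1) sets_cylinder])
    fix \<omega> \<omega>' :: "nat \<Rightarrow> nat" assume "\<And>k. k \<in> {..i} \<Longrightarrow> \<omega> k = \<omega>' k"
    then have "chain i \<omega> = chain i \<omega>'"
      by (intro chain_cong) auto
    then show "\<omega> \<in> ?A \<longleftrightarrow> \<omega>' \<in> ?A"
      by simp
  qed auto
  moreover have eq: "{\<omega>. \<omega> (Suc i) div 2 = r \<and> (\<forall>j\<in>{Suc (Suc i)..m}. \<omega> j div 2 \<noteq> r)} = ?B"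
    unfolding J by auto
  ultimately show ?thesis
    unfolding eq by (simp only: A(2) B)
qed

text \<open>On the event of the previous lemma, reversing the innovation at time \<open>Suc i\<close> preserves both the event and the
measure, and changes the partial sum by \<open>2 * Suc r\<close>. So at least half of the event has a partial sum of size \<open>Suc r\<close>.
Summing over the disjoint events gives a geometric series. The sum runs up to \<open>m + r\<close> so that a block started by time \<open>m\<close>
is complete.\<close>

lemma prob_large_spin_sum:
  fixes r m :: nat
  defines "p \<equiv> measure_pmf.prob \<nu> {t. t div 2 = r}"
  shows "P.prob {\<omega>. \<bar>spin_sum (m + r) \<omega>\<bar> \<ge> real (Suc r)} \<ge>
    measure_pmf.prob \<pi> {0, 1} / 2 * (1 - (1 - p) ^ m)"
proof -
  let ?big = "{\<omega>. \<bar>spin_sum (m + r) \<omega>\<bar> \<ge> real (Suc r)}"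
  define G where "G i = {\<omega>. chain i \<omega> < 2} \<inter>
      {\<omega>. \<omega> (Suc i) div 2 = r \<and> (\<forall>j\<in>{Suc (Suc i)..m}. \<omega> j div 2 \<noteq> r)}" for i
  let ?H = "\<lambda>i. G i \<inter> ?big"
  have big [measurable]: "?big \<in> sets P"
    using measurable_sets[OF measurable_spin_sum[of "m + r"], of "- {- real (Suc r) <..< real (Suc r)}"]
    by (simp add: vimage_def Collect_neg_eq[symmetric] abs_less_iff not_less[symmetric] minus_less_iff conj_commute)
  have G [measurable]: "G i \<in> sets P" for i
  proof -
    have "G i = {\<omega>. chain i \<omega> \<in> {..<2}} \<inter> {\<omega>. \<omega> (Suc i) \<in> {t. t div 2 = r}} \<inter>
        {\<omega>. \<forall>j\<in>{Suc (Suc i)..m}. \<omega> j \<in> {t. t div 2 \<noteq> r}}"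
      by (auto simp: G_def)
    then show ?thesis
      using sets_chain[of i "{..<2}"] sets_coordinate[of "Suc i" "{t. t div 2 = r}"]
        sets_cylinder[of "{Suc (Suc i)..m}" "\<lambda>_. {t. t div 2 \<noteq> r}"] by auto
  qed
  have H: "P.prob (?H i) \<ge> P.prob (G i) / 2" if "i < m" for i
  proof -
    let ?T = "flip_on {Suc i}"
    have "G i \<subseteq> ?H i \<union> ?T -` ?H i"
    proof
      fix \<omega> assume \<omega>: "\<omega> \<in> G i"
      have "chain i (?T \<omega>) = chain i \<omega>"
        by (rule chain_cong) (auto simp: flip_on_def)
      then have "?T \<omega> \<in> G i"
        using \<omega> by (auto simp: G_def flip_on_def)
      moreover have "\<bar>spin_sum (m + r) \<omega> - spin_sum (m + r) (?T \<omega>)\<bar> = 2 * real (Suc r)"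
        using \<omega> \<open>i < m\<close> by (intro spin_sum_flip_block) (auto simp: G_def)
      then have "\<bar>spin_sum (m + r) \<omega>\<bar> \<ge> real (Suc r) \<or> \<bar>spin_sum (m + r) (?T \<omega>)\<bar> \<ge> real (Suc r)"
        by (smt (verit))
      ultimately show "\<omega> \<in> ?H i \<union> ?T -` ?H i"
        using \<omega> by auto
    qed
    moreover have T: "?T -` ?H i \<in> sets P" and Hi: "?H i \<in> sets P"
      using measurable_sets[OF measurable_flip_on, of "?H i" "{Suc i}"] big G[of i] by simp_all
    ultimately have "P.prob (G i) \<le> P.prob (?H i \<union> ?T -` ?H i)"
      by (intro P.finite_measure_mono sets.Un)
    also have "\<dots> \<le> P.prob (?H i) + P.prob (?T -` ?H i)"
      by (rule measure_Un_le[OF Hi T])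
    also have "P.prob (?T -` ?H i) = measure (distr P P ?T) (?H i)"
      by (subst measure_distr) auto
    finally show ?thesis
      by (simp add: distr_flip_on)
  qed
  have disj: "disjoint_family_on ?H {..<m}"
  proof -
    have "G i \<inter> G j = {}" if "i < j" "j < m" for i j
      using that by (auto simp: G_def)
    then show ?thesis
      unfolding disjoint_family_on_def by (metis (no_types, lifting) Int_assoc Int_commute Int_empty_right inf.left_commute lessThan_iff linorder_neqE_nat)
  qed
  have "measure_pmf.prob \<pi> {0, 1} / 2 * (1 - (1 - p) ^ m) =
      measure_pmf.prob \<pi> {0, 1} / 2 * (p * (\<Sum>i<m. (1 - p) ^ i))"
    using one_diff_power_eq[of "1 - p" m] by simp
  also have "\<dots> = measure_pmf.prob \<pi> {0, 1} / 2 * (p * (\<Sum>i<m. (1 - p) ^ (m - Suc i)))"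
    by (simp only: sum.nat_diff_reindex)
  also have "\<dots> = (\<Sum>i<m. P.prob (G i) / 2)"
    unfolding sum_distrib_left
    by (intro sum.cong) (simp_all add: G_def prob_last_block p_def)
  also have "\<dots> \<le> (\<Sum>i<m. P.prob (?H i))"
    by (intro sum_mono H) simp
  also have "\<dots> = P.prob (\<Union>i<m. ?H i)"
    using disj by (intro P.finite_measure_finite_Union[symmetric]) auto
  also have "\<dots> \<le> P.prob ?big"
    by (rule P.finite_measure_mono[OF _ big]) auto
  finally show ?thesis .
qed

end

section \<open>Weighted sums of truncated block lengths\<close>

lemma powr_three_halves: "real n powr (3/2) = real n * sqrt (real n)"
proof (cases "n = 0")
  case False
  have "real n powr (3/2) = real n powr (1 + 1/2)"
    by simp
  also have "\<dots> = real n * sqrt (real n)"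
    using False by (simp only: powr_add powr_half_sqrt) simp
  finally show ?thesis .
qed simp

lemma inverse_sqrt_le_diff:
  fixes x :: real
  assumes "x \<ge> 0"
  shows "1 / sqrt (x + 1) \<le> 2 * (sqrt (x + 1) - sqrt x)"
proof -
  define s t where "s = sqrt x" and "t = sqrt (x + 1)"
  have st: "0 \<le> s" "s \<le> t" "0 < t" "t * t - s * s = 1"
    using assms by (auto simp: s_def t_def)
  have "1 = (t + s) * (t - s)"
    using st(4) by (simp add: algebra_simps)
  also have "\<dots> \<le> (2 * t) * (t - s)"
    using st by (intro mult_right_mono) auto
  finally show ?thesis
    using st unfolding s_def[symmetric] t_def[symmetric] by (simp add: field_simps)
qed

lemma inverse_powr_le_diff:
  fixes x :: real
  assumes "x > 0"
  shows "1 / ((x + 1) * sqrt (x + 1)) \<le> 2 / sqrt x - 2 / sqrt (x + 1)"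
proof -
  define s t where "s = sqrt x" and "t = sqrt (x + 1)"
  have st: "0 < s" "s \<le> t" "0 < t" "t * t - s * s = 1" and t2: "t * t = x + 1"
    using assms by (auto simp: s_def t_def)
  have diff: "1 = (t + s) * (t - s)"
    using st(4) by (simp add: algebra_simps)
  have "s * (t + s) \<le> t * (t + t)"
    using st by (intro mult_mono) auto
  then have "s * (t + s) * (t - s) \<le> t * (t + t) * (t - s)"
    using st by (intro mult_right_mono) auto
  also have "s * (t + s) * (t - s) = s"
    using diff by (simp only: mult.assoc mult_1_right)
  finally have "s \<le> 2 * (t * t) * (t - s)"
    by (simp add: algebra_simps)
  then have "s / (s * (t * t * t)) \<le> 2 * (t * t) * (t - s) / (s * (t * t * t))"
    using st(1,3) by (intro divide_right_mono) auto
  also have "2 * (t * t) * (t - s) / (s * (t * t * t)) = 2 / s - 2 / t"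
    using st(1,3) by (simp add: field_simps)
  also have "s / (s * (t * t * t)) = 1 / (t * t * t)"
    using st(1) by simp
  finally have "1 / (t * t * t) \<le> 2 / s - 2 / t" .
  then show ?thesis
    unfolding s_def[symmetric] t_def[symmetric] unfolding t2[symmetric] .
qed

text \<open>Up to \<open>L\<close> the terms are \<open>1 / sqrt n\<close>, beyond \<open>L\<close> they are \<open>L / n powr (3/2)\<close>. Both are dominated by telescoping differences, which
gives the explicit bound carried through the induction.\<close>

lemma sum_min_over_powr_le:
  assumes "L \<ge> 1"
  shows "(\<Sum>n=1..N. real (min n L) / real n powr (3/2)) \<le> 4 * sqrt (real L)"
proof -
  \<comment> \<open>The two bounds agree at \<open>N = L\<close>.\<close>
  have "(\<Sum>n=1..N. real (min n L) / real n powr (3/2)) \<le>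
      (if N \<le> L then 2 * sqrt (real N) else 4 * sqrt (real L) - 2 * real L / sqrt (real N))"
  proof (induction N)
    case (Suc N)
    let ?s = "sqrt (real N)" and ?t = "sqrt (real N + 1)"
    let ?S = "\<Sum>n=1..N. real (min n L) / real n powr (3/2)"
    have S: "(\<Sum>n=1..Suc N. real (min n L) / real n powr (3/2)) =
        ?S + real (min (Suc N) L) / ((real N + 1) * ?t)"
      by (simp add: powr_three_halves add.commute)
    show ?case
    proof (cases "Suc N \<le> L")
      case True
      then have "real (min (Suc N) L) / ((real N + 1) * ?t) = 1 / ?t"
        by (simp add: min_def add.commute)
      then show ?thesis
        using Suc True inverse_sqrt_le_diff[of "real N"] unfolding S by (simp add: add.commute)
    next
      case False
      then have N: "N \<ge> L" "N > 0"
        using assms by auto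
      have "?S \<le> 4 * sqrt (real L) - 2 * real L / ?s"
      proof (cases "N = L")
        case True
        have "real L / sqrt (real L) = sqrt (real L)"
          by (simp add: real_div_sqrt)
        with True Suc show ?thesis
          by simp
      next
        case False
        with N Suc show ?thesis by auto
      qed
      moreover have "real L * (1 / ((real N + 1) * ?t)) \<le> real L * (2 / ?s - 2 / ?t)"
        using N by (intro mult_left_mono inverse_powr_le_diff) auto
      then have "real (min (Suc N) L) / ((real N + 1) * ?t) \<le> 2 * real L / ?s - 2 * real L / ?t"
        using False by (simp add: right_diff_distrib mult.commute)
      ultimately show ?thesis
        using False unfolding S by (simp add: add.commute)
    qed
  qed simp
  also have "\<dots> \<le> 4 * sqrt (real L)"
  proof -
    have "2 * sqrt (real N) \<le> 4 * sqrt (real L)" if "N \<le> L"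
      using that by (intro mult_mono) auto
    then show ?thesis by simp
  qed
  finally show ?thesis .
qed

text \<open>The finitely many terms with a large weight contribute a constant, which is negligible against \<open>sqrt L\<close>;
the others gain the factor \<open>\<epsilon> / 8\<close> over the unweighted bound.\<close>

lemma weighted_sum_min_over_powr_small:
  fixes a :: "nat \<Rightarrow> real"
  assumes nonneg: "\<And>n. n \<ge> 1 \<Longrightarrow> a n \<ge> 0" and "a \<longlonglongrightarrow> 0" and "\<epsilon> > 0"
  shows "\<exists>L\<^sub>0\<ge>1. \<forall>L\<ge>L\<^sub>0. \<forall>N. (\<Sum>n=1..N. a n * (real (min n L) / real n powr (3/2))) \<le> \<epsilon> * sqrt (real L)"
proof -
  obtain n\<^sub>0 where n\<^sub>0: "\<And>n. n \<ge> n\<^sub>0 \<Longrightarrow> a n < \<epsilon> / 8"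
    using order_tendstoD(2)[OF \<open>a \<longlonglongrightarrow> 0\<close>, of "\<epsilon> / 8"] \<open>\<epsilon> > 0\<close> by (auto simp: eventually_sequentially)
  define C where "C = (\<Sum>n=1..n\<^sub>0. a n)"
  have C: "C \<ge> 0"
    unfolding C_def by (intro sum_nonneg nonneg) auto
  obtain L\<^sub>0 :: nat where L\<^sub>0: "real L\<^sub>0 \<ge> (2 * C / \<epsilon>)\<^sup>2"
    using real_arch_simple by blast
  have "(\<Sum>n=1..N. a n * (real (min n L) / real n powr (3/2))) \<le> \<epsilon> * sqrt (real L)"
    if L: "L \<ge> max 1 L\<^sub>0" for L N
  proof -
    let ?b = "\<lambda>n. real (min n L) / real n powr (3/2)"
    have b1: "?b n \<le> 1" if "n \<ge> 1" for n
    proof -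
      have "real (min n L) * 1 \<le> real n * sqrt (real n)"
        using that by (intro mult_mono) auto
      then show ?thesis
        using that by (simp add: powr_three_halves divide_le_eq)
    qed
    have "a n * ?b n \<le> (if n \<le> n\<^sub>0 then a n else 0) + \<epsilon> / 8 * ?b n" if "n \<ge> 1" for n
    proof (cases "n \<le> n\<^sub>0")
      case True
      have "a n * ?b n \<le> a n * 1"
        by (rule mult_left_mono[OF b1[OF that] nonneg[OF that]])
      moreover have "0 \<le> \<epsilon> / 8 * ?b n"
        using \<open>\<epsilon> > 0\<close> by simp
      ultimately show ?thesis
        using True by simp
    next
      case False
      then have "a n * ?b n \<le> \<epsilon> / 8 * ?b n"
        using n\<^sub>0[of n] by (intro mult_right_mono) auto
      with False show ?thesis by simp
    qed
    then have "(\<Sum>n=1..N. a n * ?b n) \<le> (\<Sum>n=1..N. (if n \<le> n\<^sub>0 then a n else 0) + \<epsilon> / 8 * ?b n)"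
      by (intro sum_mono) auto
    also have "\<dots> = (\<Sum>n=1..N. if n \<le> n\<^sub>0 then a n else 0) + \<epsilon> / 8 * (\<Sum>n=1..N. ?b n)"
      by (simp only: sum.distrib sum_distrib_left)
    also have "(\<Sum>n=1..N. if n \<le> n\<^sub>0 then a n else 0) = (\<Sum>n\<in>{1..min N n\<^sub>0}. a n)"
      by (intro sum.mono_neutral_cong_right) auto
    also have "\<dots> \<le> C"
      unfolding C_def by (intro sum_mono2) (auto intro: nonneg)
    also have "C \<le> \<epsilon> / 2 * sqrt (real L)"
    proof -
      have "2 * C / \<epsilon> \<le> sqrt (real L)"
        using L L\<^sub>0 by (intro real_le_rsqrt) auto
      then show ?thesis
        using \<open>\<epsilon> > 0\<close> by (simp add: field_simps)
    qed
    also have "\<epsilon> / 8 * (\<Sum>n=1..N. ?b n) \<le> \<epsilon> / 8 * (4 * sqrt (real L))"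
      using L \<open>\<epsilon> > 0\<close> by (intro mult_left_mono sum_min_over_powr_le) auto
    finally show ?thesis
      by (simp add: algebra_simps)
  qed
  then show ?thesis
    by (intro exI[of _ "max 1 L\<^sub>0"]) auto
qed

section \<open>Blocks of random length\<close>

lemma sqrt_suminf_squares_le:
  fixes f :: "nat \<Rightarrow> real"
  assumes "summable f" "\<And>k. f k \<ge> 0"
  shows "summable (\<lambda>k. (f k)\<^sup>2)" "sqrt (\<Sum>k. (f k)\<^sup>2) \<le> (\<Sum>k. f k)"
proof -
  have le: "f k \<le> suminf f" for k
    using sum_le_suminf[OF assms(1), of "{k}"] assms(2) by auto
  have le2: "(f k)\<^sup>2 \<le> suminf f * f k" for k
    unfolding power2_eq_square by (intro mult_right_mono le assms(2))
  show s: "summable (\<lambda>k. (f k)\<^sup>2)"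
    by (rule summable_comparison_test'[OF summable_mult[OF assms(1), of "suminf f"]]) (use le2 in auto)
  have "(\<Sum>k. (f k)\<^sup>2) \<le> (\<Sum>k. suminf f * f k)"
    by (intro suminf_le le2 s summable_mult assms(1))
  also have "\<dots> = (suminf f)\<^sup>2"
    using assms(1) by (simp add: suminf_mult power2_eq_square)
  finally show "sqrt (\<Sum>k. (f k)\<^sup>2) \<le> suminf f"
    using suminf_nonneg[OF assms] by (simp add: real_le_lsqrt)
qed

lemma integral_pmf_nat:
  fixes f :: "nat \<Rightarrow> real"
  assumes "summable (\<lambda>k. pmf p k * f k)" "\<And>k. f k \<ge> 0"
  shows "(\<integral>k. f k \<partial>measure_pmf p) = (\<Sum>k. pmf p k * f k)"
proof -
  have "(\<integral>k. f k \<partial>measure_pmf p) = (\<integral>k. pmf p k * f k \<partial>count_space UNIV)"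
    unfolding measure_pmf_eq_density by (subst integral_density) auto
  also have "\<dots> = (\<Sum>k. pmf p k * f k)"
    using assms by (intro integral_count_space_nat) (simp add: integrable_count_space_nat_iff)
  finally show ?thesis .
qed

lemma pmf_embed_pmf_sums:
  fixes f :: "nat \<Rightarrow> real"
  assumes "\<And>k. f k \<ge> 0" "f sums 1"
  shows "pmf (embed_pmf f) k = f k"
proof (rule pmf_embed_pmf)
  show "(\<integral>\<^sup>+k. ennreal (f k) \<partial>count_space UNIV) = 1"
    using assms sums_unique[OF assms(2)] by (simp add: nn_integral_count_space_nat suminf_ennreal_eq)
qed (rule assms(1))

lemma flip_invariantI: "(\<And>y. pmf p (flip y) = pmf p y) \<Longrightarrow> map_pmf flip p = p"
  by (rule pmf_eqI, metis flip_flip pmf_map_inj' injI)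

text \<open>Block type \<open>k\<close> has length \<open>L k\<close>. The chain in equilibrium sees the types with the size-biased law \<open>\<kappa>'\<close>, and its position
within a block is uniform; \<open>c\<close> is the reciprocal of the mean block length.\<close>

locale block_mixture =
  fixes \<kappa> \<kappa>' :: "nat pmf" and L :: "nat \<Rightarrow> nat" and c :: real
  assumes L_pos: "\<And>k. L k > 0"
    and size_biased: "\<And>k. pmf \<kappa>' k = c * real (L k) * pmf \<kappa> k"
begin

text \<open>A fresh block of length \<open>L k\<close> starts with \<open>L k - 1\<close> steps still to go.\<close>

definition innovation_pmf :: "nat pmf" where
  "innovation_pmf = bind_pmf \<kappa> (\<lambda>k. pmf_of_set {2 * (L k - 1), Suc (2 * (L k - 1))})"

definition stationary_pmf :: "nat pmf" where
  "stationary_pmf = bind_pmf \<kappa>' (\<lambda>k. pmf_of_set {..<2 * L k})"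

lemma c_pos: "c > 0"
proof -
  obtain k where "k \<in> set_pmf \<kappa>'"
    using set_pmf_not_empty[of \<kappa>'] by blast
  then have "c * (real (L k) * pmf \<kappa> k) > 0"
    using pmf_positive[of k \<kappa>'] by (simp only: size_biased mult.assoc)
  moreover have "real (L k) * pmf \<kappa> k \<ge> 0"
    by simp
  ultimately show ?thesis
    using mult_nonpos_nonneg[of c "real (L k) * pmf \<kappa> k"] by linarith
qed

lemma measure_size_biased: "measure_pmf \<kappa>' = density \<kappa> (\<lambda>k. c * real (L k))"
proof (rule measure_eqI_countable[where A=UNIV])
  fix k
  have "emeasure (density \<kappa> (\<lambda>k. c * real (L k))) {k} =
      (\<integral>\<^sup>+j. ennreal (c * real (L k)) * indicator {k} j \<partial>\<kappa>)"
    by (auto simp: emeasure_density indicator_def intro!: nn_integral_cong)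
  also have "\<dots> = ennreal (c * real (L k)) * ennreal (pmf \<kappa> k)"
    by (simp add: nn_integral_cmult_indicator emeasure_pmf_single)
  also have "\<dots> = emeasure (measure_pmf \<kappa>') {k}"
    using c_pos by (simp add: emeasure_pmf_single size_biased ennreal_mult[symmetric])
  finally show "emeasure (measure_pmf \<kappa>') {k} = emeasure (density \<kappa> (\<lambda>k. c * real (L k))) {k}" ..
qed auto

text \<open>The size bias cancels the weight \<open>1 / L k\<close> of the uniform position, so the remaining lifetime has the usual
equilibrium density of renewal theory, proportional to the tail of the block length.\<close>

lemma pmf_stationary: "pmf stationary_pmf y = c / 2 * measure_pmf.prob \<kappa> {k. y div 2 < L k}"
proof -
  have "pmf stationary_pmf y = (\<integral>k. indicator {..<2 * L k} y / real (2 * L k) \<partial>\<kappa>')"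
    using L_pos by (simp add: stationary_pmf_def pmf_bind pmf_of_set lessThan_empty_iff)
  also have "\<dots> = (\<integral>k. c * real (L k) * (indicator {..<2 * L k} y / real (2 * L k)) \<partial>\<kappa>)"
    unfolding measure_size_biased using c_pos by (subst integral_density) auto
  also have "\<dots> = (\<integral>k. c / 2 * indicator {k. y div 2 < L k} k \<partial>\<kappa>)"
    using L_pos by (intro Bochner_Integration.integral_cong) (auto simp: indicator_def)
  also have "\<dots> = c / 2 * measure_pmf.prob \<kappa> {k. y div 2 < L k}"
    by simp
  finally show ?thesis .
qed

lemma pmf_innovation: "pmf innovation_pmf y = measure_pmf.prob \<kappa> {k. L k = Suc (y div 2)} / 2"
proof -
  have "y = 2 * (L k - 1) \<or> y = Suc (2 * (L k - 1)) \<longleftrightarrow> L k = Suc (y div 2)" for k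
    using L_pos[of k] by (cases "L k") auto
  then have "pmf innovation_pmf y = (\<integral>k. indicator {k. L k = Suc (y div 2)} k / 2 \<partial>\<kappa>)"
    by (simp add: innovation_pmf_def pmf_bind pmf_of_set indicator_def)
  then show ?thesis
    by simp
qed

sublocale block_chain stationary_pmf innovation_pmf
proof
  fix y
  have "measure_pmf.prob \<kappa> {k. y div 2 < L k} =
      measure_pmf.prob \<kappa> ({k. L k = Suc (y div 2)} \<union> {k. Suc (y div 2) < L k})"
    by (rule arg_cong[where f="measure_pmf.prob \<kappa>"]) auto
  also have "\<dots> = measure_pmf.prob \<kappa> {k. L k = Suc (y div 2)} + measure_pmf.prob \<kappa> {k. Suc (y div 2) < L k}"
    by (rule measure_pmf.finite_measure_Union) auto
  finally show "pmf stationary_pmf y =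
      (pmf stationary_pmf 0 + pmf stationary_pmf 1) * pmf innovation_pmf y + pmf stationary_pmf (y + 2)"
    using L_pos by (simp add: pmf_stationary pmf_innovation algebra_simps)
next
  show "map_pmf flip stationary_pmf = stationary_pmf"
    by (rule flip_invariantI) (simp add: pmf_stationary)
  show "map_pmf flip innovation_pmf = innovation_pmf"
    by (rule flip_invariantI) (simp add: pmf_innovation)
qed

lemma prob_stationary_01: "measure_pmf.prob stationary_pmf {0, 1} = c"
  using L_pos by (subst measure_measure_pmf_finite) (auto simp: pmf_stationary)

lemma prob_innovation_ge: "measure_pmf.prob innovation_pmf {t. t div 2 = L k - 1} \<ge> pmf \<kappa> k"
proof -
  let ?R = "{t. t div 2 = L k - 1}"
  have "ennreal (pmf \<kappa> k) = (\<integral>\<^sup>+j. indicator {k} j \<partial>\<kappa>)"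
    by (simp add: emeasure_pmf_single)
  also have "\<dots> \<le> (\<integral>\<^sup>+j. emeasure (measure_pmf (pmf_of_set {2 * (L j - 1), Suc (2 * (L j - 1))})) ?R \<partial>\<kappa>)"
  proof (rule nn_integral_mono)
    fix j
    have "set_pmf (pmf_of_set {2 * (L k - 1), Suc (2 * (L k - 1))}) \<subseteq> ?R"
      by (subst set_pmf_of_set) auto
    then have "emeasure (measure_pmf (pmf_of_set {2 * (L k - 1), Suc (2 * (L k - 1))})) ?R = 1"
      by (auto simp: measure_pmf.emeasure_eq_1_AE AE_measure_pmf_iff)
    then show "indicator {k} j \<le> emeasure (measure_pmf (pmf_of_set {2 * (L j - 1), Suc (2 * (L j - 1))})) ?R"
      by (auto simp: indicator_def)
  qed
  also have "\<dots> = emeasure (measure_pmf innovation_pmf) ?R"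
    by (simp add: innovation_pmf_def emeasure_bind_pmf)
  finally show ?thesis
    by (simp add: measure_pmf.emeasure_eq_measure)
qed

lemma integral_stationary_le:
  "(\<integral>y. (real (min n (y div 2)))\<^sup>2 \<partial>stationary_pmf) \<le> (\<integral>k. (real (min n (L k)))\<^sup>2 \<partial>\<kappa>')"
proof -
  have int: "integrable (measure_pmf p) (\<lambda>x. (real (min n (h x)))\<^sup>2)" for p :: "nat pmf" and h :: "nat \<Rightarrow> nat"
    by (rule measure_pmf.integrable_const_bound[of _ "(real n)\<^sup>2"]) (auto intro!: power_mono)
  have "ennreal (\<integral>y. (real (min n (y div 2)))\<^sup>2 \<partial>stationary_pmf) =
      (\<integral>\<^sup>+y. ennreal ((real (min n (y div 2)))\<^sup>2) \<partial>stationary_pmf)"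
    by (intro nn_integral_eq_integral[symmetric] int) auto
  also have "\<dots> = (\<integral>\<^sup>+k. \<integral>\<^sup>+y. ennreal ((real (min n (y div 2)))\<^sup>2) \<partial>pmf_of_set {..<2 * L k} \<partial>\<kappa>')"
    by (simp only: stationary_pmf_def nn_integral_bind_pmf)
  also have "\<dots> \<le> (\<integral>\<^sup>+k. ennreal ((real (min n (L k)))\<^sup>2) \<partial>\<kappa>')"
  proof (rule nn_integral_mono)
    fix k
    have "set_pmf (pmf_of_set {..<2 * L k}) = {..<2 * L k}"
    proof (rule set_pmf_of_set)
      have "0 \<in> {..<2 * L k}"
        using L_pos[of k] by simp
      then show "{..<2 * L k} \<noteq> {}"
        by blast
    qed simp
    then have "AE y in pmf_of_set {..<2 * L k}. y < 2 * L k"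
      by (simp add: AE_measure_pmf_iff)
    then have "AE y in pmf_of_set {..<2 * L k}.
        ennreal ((real (min n (y div 2)))\<^sup>2) \<le> ennreal ((real (min n (L k)))\<^sup>2)"
    proof (rule AE_mp, intro AE_I2 impI)
      fix y assume "y < 2 * L k"
      then have "y div 2 \<le> L k"
        by linarith
      then have "min n (y div 2) \<le> min n (L k)"
        by (intro min.mono) auto
      then show "ennreal ((real (min n (y div 2)))\<^sup>2) \<le> ennreal ((real (min n (L k)))\<^sup>2)"
        by (intro ennreal_leI power_mono) (simp_all only: of_nat_le_iff of_nat_0_le_iff)
    qed
    then have "(\<integral>\<^sup>+y. ennreal ((real (min n (y div 2)))\<^sup>2) \<partial>pmf_of_set {..<2 * L k}) \<le>
        (\<integral>\<^sup>+y. ennreal ((real (min n (L k)))\<^sup>2) \<partial>pmf_of_set {..<2 * L k})"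
      by (rule nn_integral_mono_AE)
    also have "\<dots> = ennreal ((real (min n (L k)))\<^sup>2)"
      by (simp only: nn_integral_const measure_pmf.emeasure_space_1 mult_1_right)
    finally show "(\<integral>\<^sup>+y. ennreal ((real (min n (y div 2)))\<^sup>2) \<partial>pmf_of_set {..<2 * L k}) \<le> ennreal ((real (min n (L k)))\<^sup>2)" .
  qed
  also have "\<dots> = ennreal (\<integral>k. (real (min n (L k)))\<^sup>2 \<partial>\<kappa>')"
    by (intro nn_integral_eq_integral int) auto
  finally show ?thesis
    by (simp add: integral_nonneg_AE)
qed

text \<open>The lifetime left in a block of length \<open>L k\<close> is bounded by \<open>L k\<close>, and an \<open>\<ell>\<^sup>2\<close> norm is at most the \<open>\<ell>\<^sup>1\<close>
norm. Passing to the latter makes the estimate linear in the block types, which can then be treated one at a time.\<close>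

lemma norm_cond_exp_le:
  assumes "summable (\<lambda>k. sqrt (pmf \<kappa>' k) * real (min n (L k)))"
  shows "norm_L2 P (cond_exp_given P (count_space UNIV) (chain 0) (spin_sum n)) \<le>
    (\<Sum>k. sqrt (pmf \<kappa>' k) * real (min n (L k)))"
proof -
  let ?f = "\<lambda>k. sqrt (pmf \<kappa>' k) * real (min n (L k))"
  have sq: "(?f k)\<^sup>2 = pmf \<kappa>' k * (real (min n (L k)))\<^sup>2" for k
    by (simp add: power_mult_distrib)
  have nonneg: "?f k \<ge> 0" for k
    by simp
  have "norm_L2 P (cond_exp_given P (count_space UNIV) (chain 0) (spin_sum n)) \<le>
      sqrt (\<integral>k. (real (min n (L k)))\<^sup>2 \<partial>\<kappa>')"
    unfolding norm_cond_exp_spin_sum by (intro real_sqrt_le_mono integral_stationary_le)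
  also have "\<dots> = sqrt (\<Sum>k. (?f k)\<^sup>2)"
    using sqrt_suminf_squares_le(1)[OF assms nonneg] unfolding sq
    by (subst integral_pmf_nat) simp_all
  also have "\<dots> \<le> suminf ?f"
    by (rule sqrt_suminf_squares_le(2)[OF assms nonneg])
  finally show ?thesis .
qed

text \<open>The partial sums over \<open>n\<close> and the series over the block types are interchanged, so that the hypothesis on each type can be
used inside.\<close>

lemma summable_weighted_norms:
  fixes a :: "nat \<Rightarrow> real"
  assumes a: "\<And>n. n \<ge> 1 \<Longrightarrow> a n \<ge> 0"
    and sum_le: "\<And>k N. (\<Sum>n=1..N. a n * (real (min n (L k)) / real n powr (3/2))) \<le> b k"
    and s: "summable (\<lambda>k. sqrt (pmf \<kappa>' k))" and sb: "summable (\<lambda>k. sqrt (pmf \<kappa>' k) * b k)"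
  shows "summable (\<lambda>m. a (Suc m) * norm_L2 P (cond_exp_given P (count_space UNIV) (chain 0)
    (spin_sum (Suc m))) / real (Suc m) powr (3/2))"
proof (rule summableI_nonneg_bounded)
  let ?norm = "\<lambda>n. norm_L2 P (cond_exp_given P (count_space UNIV) (chain 0) (spin_sum n))"
  let ?s = "\<lambda>k. sqrt (pmf \<kappa>' k)"
  show "0 \<le> a (Suc m) * ?norm (Suc m) / real (Suc m) powr (3/2)" for m
    using a[of "Suc m"] by (simp add: norm_L2_def integral_nonneg_AE)
  have summ: "summable (\<lambda>k. ?s k * real (min n (L k)))" for n
    by (rule summable_comparison_test'[OF summable_mult[OF s, of "real n"]])
      (auto simp: mult.commute[of "real n"] intro!: mult_left_mono)
  show "(\<Sum>m<N. a (Suc m) * ?norm (Suc m) / real (Suc m) powr (3/2)) \<le> (\<Sum>k. ?s k * b k)" for N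
  proof -
    have term_eq: "?s k * (a n * (real (min n (L k)) / real n powr (3/2))) =
        a n / real n powr (3/2) * (?s k * real (min n (L k)))" for k n
      by simp
    have summ': "summable (\<lambda>k. ?s k * (a n * (real (min n (L k)) / real n powr (3/2))))" for n
      unfolding term_eq by (intro summable_mult summ)
    have "(\<Sum>m<N. a (Suc m) * ?norm (Suc m) / real (Suc m) powr (3/2)) =
        (\<Sum>n=1..N. a n / real n powr (3/2) * ?norm n)"
      by (rule sum.reindex_bij_witness[of _ "\<lambda>n. n - 1" Suc]) auto
    also have "\<dots> \<le> (\<Sum>n=1..N. a n / real n powr (3/2) * (\<Sum>k. ?s k * real (min n (L k))))"
      using a by (intro sum_mono mult_left_mono norm_cond_exp_le summ) auto
    also have "\<dots> = (\<Sum>n=1..N. \<Sum>k. ?s k * (a n * (real (min n (L k)) / real n powr (3/2))))"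
      unfolding term_eq by (intro sum.cong refl suminf_mult[symmetric] summ)
    also have "\<dots> = (\<Sum>k. \<Sum>n=1..N. ?s k * (a n * (real (min n (L k)) / real n powr (3/2))))"
      by (intro suminf_sum[symmetric] summ')
    also have "\<dots> \<le> (\<Sum>k. ?s k * b k)"
    proof (rule suminf_le)
      show "(\<Sum>n=1..N. ?s k * (a n * (real (min n (L k)) / real n powr (3/2)))) \<le> ?s k * b k" for k
        unfolding sum_distrib_left[symmetric] by (intro mult_left_mono sum_le) simp
    qed (intro summable_sum summ' sb)+
    finally show ?thesis .
  qed
qed

text \<open>Among \<open>m\<close> innovations the expected number of type \<open>k\<close> is at least one, so the probability \<open>(1 - p) ^ m\<close> that none of them
has the corresponding length is at most \<open>exp (- 1)\<close>, hence at most one half.\<close>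

lemma prob_long_block:
  assumes "real m * pmf \<kappa> k \<ge> 1"
  shows "P.prob {\<omega>. \<bar>spin_sum (m + (L k - 1)) \<omega>\<bar> \<ge> real (L k)} \<ge> c / 4"
proof -
  let ?p = "measure_pmf.prob innovation_pmf {t. t div 2 = L k - 1}"
  have "1 \<le> real m * ?p"
    using assms mult_left_mono[OF prob_innovation_ge[of k], of "real m"] by simp
  have "(1 - ?p) ^ m \<le> exp (- ?p) ^ m"
    using exp_ge_add_one_self[of "- ?p"] by (intro power_mono) auto
  also have "\<dots> = exp (- (real m * ?p))"
    by (simp add: exp_of_nat_mult[symmetric])
  also have "\<dots> \<le> exp (- 1)"
    using \<open>1 \<le> real m * ?p\<close> by simp
  also have "\<dots> \<le> 1 / 2"
    using exp_ge_add_one_self[of 1] by (simp add: exp_minus field_simps)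
  finally have "c / 2 * (1 / 2) \<le> c / 2 * (1 - (1 - ?p) ^ m)"
    using c_pos by (intro mult_left_mono) auto
  also have "\<dots> \<le> P.prob {\<omega>. \<bar>spin_sum (m + (L k - 1)) \<omega>\<bar> \<ge> real (Suc (L k - 1))}"
    using prob_large_spin_sum[of "L k - 1" m] by (simp only: prob_stationary_01)
  finally show ?thesis
    using L_pos[of k] by simp
qed

end

section \<open>Failure of tightness and the counterexample\<close>

lemma (in prob_space) not_stochastically_boundedI:
  assumes "\<delta> > 0" and "\<And>K :: real. \<exists>n\<in>I. \<P>(\<omega> in M. \<bar>Z n \<omega>\<bar> > K) \<ge> \<delta>"
  shows "\<not> stochastically_bounded M I Z"
proof
  assume "stochastically_bounded M I Z"
  then have "eventually (\<lambda>K::real. (SUP n\<in>I. \<P>(\<omega> in M. \<bar>Z n \<omega>\<bar> > K)) < \<delta>) at_top"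
    unfolding stochastically_bounded_def using \<open>\<delta> > 0\<close> by (rule order_tendstoD)
  then obtain K where K: "(SUP n\<in>I. \<P>(\<omega> in M. \<bar>Z n \<omega>\<bar> > K)) < \<delta>"
    by (meson eventually_happens trivial_limit_at_top_linorder)
  obtain n where n: "n \<in> I" "\<P>(\<omega> in M. \<bar>Z n \<omega>\<bar> > K) \<ge> \<delta>"
    using assms(2) by blast
  have "\<P>(\<omega> in M. \<bar>Z n \<omega>\<bar> > K) \<le> (SUP n\<in>I. \<P>(\<omega> in M. \<bar>Z n \<omega>\<bar> > K))"
    using n(1) by (intro cSUP_upper bdd_aboveI[of _ 1]) auto
  with n(2) K show False
    by linarith
qed

theorem theorem1p2:
  fixes a :: "nat \<Rightarrow> real"
  assumes "\<And>n. n \<ge> 1 \<Longrightarrow> a n \<ge> 0"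
    and "a \<longlonglongrightarrow> 0"
  shows "\<exists>(M :: (nat \<Rightarrow> nat) measure) (S :: nat set) (Y :: nat \<Rightarrow> (nat \<Rightarrow> nat) \<Rightarrow> nat) (g :: nat \<Rightarrow> real).
    stationary_ergodic_markov_chain M S Y \<and>
    (let X = (\<lambda>i \<omega>. g (Y i \<omega>));
         T = (\<lambda>n \<omega>. \<Sum>i=1..n. X i \<omega>)
     in integrable M (\<lambda>\<omega>. (X 1 \<omega>)\<^sup>2) \<and>
        (\<integral>\<omega>. X 1 \<omega> \<partial>M) = 0 \<and>
        summable (\<lambda>m. let n = Suc m in
          a n * norm_L2 M (cond_exp_given M (count_space S) (Y 0) (T n)) / real n powr (3/2)) \<and>
        \<not> stochastically_bounded M {1..} (\<lambda>n \<omega>. T n \<omega> / sqrt (real n)))"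
proof -
  \<comment> \<open>The bound \<open>L k \<ge> 16 ^ k\<close> makes \<open>4 ^ k / L k\<close> and its square root \<open>2 ^ k / sqrt (L k)\<close> summable; multiplied by \<open>2 ^ k / sqrt (L k)\<close>, the second bound leaves \<open>(1/2) ^ k\<close>.\<close>
  have "\<forall>k. \<exists>L. L \<ge> 16 ^ k \<and> (\<forall>N. (\<Sum>n=1..N. a n * (real (min n L) / real n powr (3/2))) \<le> (1/4) ^ k * sqrt (real L))"
  proof
    fix k
    obtain L\<^sub>0 where L\<^sub>0: "\<forall>L\<ge>L\<^sub>0. \<forall>N. (\<Sum>n=1..N. a n * (real (min n L) / real n powr (3/2))) \<le> (1/4) ^ k * sqrt (real L)"
      using weighted_sum_min_over_powr_small[OF assms, of "(1/4) ^ k"] by auto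
    show "\<exists>L. L \<ge> 16 ^ k \<and> (\<forall>N. (\<Sum>n=1..N. a n * (real (min n L) / real n powr (3/2))) \<le> (1/4) ^ k * sqrt (real L))"
    proof (intro exI[of _ "max L\<^sub>0 (16 ^ k)"] conjI)
      show "\<forall>N. (\<Sum>n=1..N. a n * (real (min n (max L\<^sub>0 (16 ^ k))) / real n powr (3/2))) \<le> (1/4) ^ k * sqrt (real (max L\<^sub>0 (16 ^ k)))"
        by (intro allI L\<^sub>0[rule_format]) simp
    qed simp
  qed
  from choice[OF this] obtain L :: "nat \<Rightarrow> nat" where L16: "\<And>k. L k \<ge> 16 ^ k"
    and L_sum: "\<And>k N. (\<Sum>n=1..N. a n * (real (min n (L k)) / real n powr (3/2))) \<le> (1/4) ^ k * sqrt (real (L k))"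
    by blast
  have L16': "real (L k) \<ge> 16 ^ k" for k
    using of_nat_mono[OF L16[of k], where ?'a = real] by simp
  have L_pos: "L k > 0" for k
    by (rule less_le_trans[OF _ L16]) simp
  have L1: "real (L k) \<ge> 1" for k
    using L_pos[of k] by simp
  \<comment> \<open>Unnormalised law of the block length and its size-biased version. The factor \<open>4 ^ k\<close> makes blocks of length \<open>L k\<close> so frequent that one appears within about \<open>L k ^ 2 / 4 ^ k\<close> steps.\<close>
  define w where "w k = 4 ^ k / (real (L k))\<^sup>2" for k
  define v where "v k = 4 ^ k / real (L k)" for k
  have pos: "w k > 0" "v k > 0" for k
    using L_pos[of k] by (auto simp: w_def v_def)
  have v_le: "v k \<le> (1/4) ^ k" for k
  proof -
    have "v k \<le> 4 ^ k / 16 ^ k"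
      unfolding v_def using L16'[of k] by (intro divide_left_mono) (auto intro!: mult_pos_pos simp: L_pos)
    also have "\<dots> = (1/4) ^ k"
      by (simp add: power_divide[symmetric])
    finally show ?thesis .
  qed
  have w_le: "w k \<le> v k" for k
    unfolding w_def v_def using L1[of k] by (intro divide_left_mono) (auto simp: power2_eq_square intro!: mult_pos_pos)
  have summ_v: "summable v"
    by (rule summable_comparison_test'[OF summable_geometric[of "1/4 :: real"]])
      (use v_le pos(2) in \<open>auto simp: less_imp_le\<close>)
  have summ_w: "summable w"
    by (rule summable_comparison_test'[OF summ_v]) (use w_le pos(1) in \<open>auto simp: less_imp_le\<close>)
  define W where "W = suminf w"
  define V where "V = suminf v"
  have WV: "W > 0" "V > 0"
    using summ_w summ_v pos by (auto simp: W_def V_def intro!: suminf_pos)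
  define \<kappa> where "\<kappa> = embed_pmf (\<lambda>k. w k / W)"
  define \<kappa>' where "\<kappa>' = embed_pmf (\<lambda>k. v k / V)"
  have \<kappa>: "pmf \<kappa> k = w k / W" for k
    unfolding \<kappa>_def
  proof (rule pmf_embed_pmf_sums)
    show "(\<lambda>k. w k / W) sums 1"
      using sums_divide[OF summable_sums[OF summ_w], of W] WV by (simp add: W_def)
  qed (use pos WV in \<open>simp add: less_imp_le\<close>)
  have \<kappa>': "pmf \<kappa>' k = v k / V" for k
    unfolding \<kappa>'_def
  proof (rule pmf_embed_pmf_sums)
    show "(\<lambda>k. v k / V) sums 1"
      using sums_divide[OF summable_sums[OF summ_v], of V] WV by (simp add: V_def)
  qed (use pos WV in \<open>simp add: less_imp_le\<close>)
  interpret block_mixture \<kappa> \<kappa>' L "W / V"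
  proof
    show "pmf \<kappa>' k = W / V * real (L k) * pmf \<kappa> k" for k
      using WV L_pos[of k] by (simp add: \<kappa> \<kappa>' w_def v_def power2_eq_square)
  qed (rule L_pos)

  have sqrt_power: "sqrt (4 ^ k) = 2 ^ k" "sqrt (16 ^ k) = 4 ^ k" for k :: nat
    by (rule real_sqrt_unique; simp add: power2_eq_square power_mult_distrib[symmetric])+
  have sqrt_\<kappa>': "sqrt (pmf \<kappa>' k) = 2 ^ k / sqrt (real (L k)) / sqrt V" for k
    by (simp only: \<kappa>' v_def real_sqrt_divide sqrt_power)
  have sqrt_L: "sqrt (real (L k)) \<ge> 4 ^ k" for k
    using real_sqrt_le_mono[OF L16'[of k]] by (simp only: sqrt_power)
  have "summable (\<lambda>k. sqrt (pmf \<kappa>' k))"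
  proof (rule summable_comparison_test')
    show "summable (\<lambda>k. (1/2) ^ k / sqrt V)"
      by (intro summable_divide summable_geometric) simp
    fix k
    have "2 ^ k / sqrt (real (L k)) \<le> 2 ^ k / 4 ^ k"
      using sqrt_L[of k] L_pos[of k] by (intro divide_left_mono) auto
    also have "\<dots> = (1/2) ^ k"
      by (simp add: power_divide[symmetric])
    finally have "2 ^ k / sqrt (real (L k)) / sqrt V \<le> (1/2) ^ k / sqrt V"
      using WV by (intro divide_right_mono) auto
    then have "sqrt (pmf \<kappa>' k) \<le> (1/2) ^ k / sqrt V"
      unfolding sqrt_\<kappa>' .
    then show "norm (sqrt (pmf \<kappa>' k)) \<le> (1/2) ^ k / sqrt V"
      by (simp only: real_norm_def abs_of_nonneg real_sqrt_ge_zero pmf_nonneg)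
  qed
  moreover have "summable (\<lambda>k. sqrt (pmf \<kappa>' k) * ((1/4) ^ k * sqrt (real (L k))))"
  proof -
    have "sqrt (pmf \<kappa>' k) * ((1/4) ^ k * sqrt (real (L k))) = (1/2) ^ k / sqrt V" for k
    proof -
      have "sqrt (pmf \<kappa>' k) * ((1/4) ^ k * sqrt (real (L k))) = 2 ^ k * (1/4) ^ k / sqrt V"
        unfolding sqrt_\<kappa>' using L_pos[of k] by simp
      also have "2 ^ k * (1/4) ^ k = (1/2 :: real) ^ k"
        by (simp only: power_mult_distrib[symmetric]) simp
      finally show ?thesis .
    qed
    then show ?thesis
      by (simp only:) (intro summable_divide summable_geometric, simp)
  qed
  ultimately have summable: "summable (\<lambda>m. a (Suc m) * norm_L2 P (cond_exp_given P (count_space UNIV) (chain 0)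
      (spin_sum (Suc m))) / real (Suc m) powr (3/2))"
    by (intro summable_weighted_norms[OF assms(1) L_sum])

  have not_bounded: "\<not> stochastically_bounded P {1..} (\<lambda>n \<omega>. spin_sum n \<omega> / sqrt (real n))"
  proof (rule P.not_stochastically_boundedI)
    show "W / V / 4 > 0"
      using WV by simp
    fix K :: real
    obtain k where k: "K\<^sup>2 * (W + 1) < 4 ^ k"
      using real_arch_pow[of 4 "K\<^sup>2 * (W + 1)"] by auto
    \<comment> \<open>Long enough for an expected number of at least one innovation of type \<open>k\<close>; the partial sum must also leave room for the block itself.\<close>
    define m where "m = nat \<lceil>W / w k\<rceil>"
    define n where "n = m + (L k - 1)"
    have q: "W / w k > 0"
      using WV pos(1)[of k] by simp
    have m: "real m \<ge> W / w k"
      unfolding m_def by (rule real_nat_ceiling_ge)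
    have m': "real m \<le> W / w k + 1"
      using q of_int_ceiling_le_add_one[of "W / w k"] unfolding m_def by (subst of_nat_nat) linarith+
    have "m \<ge> 1"
    proof -
      have "real m > 0"
        using q m by linarith
      then show ?thesis
        by simp
    qed
    have n: "real n * 4 ^ k \<le> (W + 1) * (real (L k))\<^sup>2"
    proof -
      have "real n \<le> W / w k + real (L k)"
        using m' L1[of k] L_pos[of k] by (simp add: n_def of_nat_diff)
      then have "real n * 4 ^ k \<le> (W / w k + real (L k)) * 4 ^ k"
        by (intro mult_right_mono) auto
      also have "\<dots> = W * (real (L k))\<^sup>2 + 4 ^ k * real (L k)"
        using L_pos[of k] by (simp add: w_def algebra_simps)
      also have "4 ^ k * real (L k) \<le> real (L k) * real (L k)"
      proof (intro mult_right_mono)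
        have "(4 :: real) ^ k \<le> 16 ^ k"
          by (intro power_mono) auto
        then show "4 ^ k \<le> real (L k)"
          using L16'[of k] by linarith
      qed simp
      finally show ?thesis
        by (simp add: algebra_simps power2_eq_square)
    qed
    have big: "K < \<bar>x / sqrt (real n)\<bar>" if "real (L k) \<le> \<bar>x\<bar>" for x
    proof -
      have "n \<ge> 1"
        using \<open>m \<ge> 1\<close> by (simp add: n_def)
      have "K\<^sup>2 * real n * (W + 1) * 4 ^ k = K\<^sup>2 * (W + 1) * (real n * 4 ^ k)"
        by (simp add: algebra_simps)
      also have "\<dots> < 4 ^ k * (real n * 4 ^ k)"
        using k \<open>n \<ge> 1\<close> by (intro mult_strict_right_mono) auto
      also have "\<dots> \<le> 4 ^ k * ((W + 1) * (real (L k))\<^sup>2)"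
        by (intro mult_left_mono n) auto
      finally have "(K\<^sup>2 * real n) * ((W + 1) * 4 ^ k) < (real (L k))\<^sup>2 * ((W + 1) * 4 ^ k)"
        by (simp only: mult_ac)
      then have "(K * sqrt (real n))\<^sup>2 < (real (L k))\<^sup>2"
        using WV by (simp add: power_mult_distrib)
      then have "K * sqrt (real n) < real (L k)"
        by (rule power2_less_imp_less) simp
      then show ?thesis
        using that \<open>n \<ge> 1\<close> by (simp add: abs_divide less_divide_eq)
    qed
    have meas: "{\<omega>. \<bar>spin_sum n \<omega> / sqrt (real n)\<bar> > K} \<in> sets P"
    proof -
      have "(\<lambda>\<omega>. \<bar>spin_sum n \<omega> / sqrt (real n)\<bar>) \<in> borel_measurable P"
        by measurable
      from measurable_sets[OF this, of "{K<..}"] show ?thesis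
        by (simp add: vimage_def)
    qed
    have "W / V / 4 \<le> P.prob {\<omega>. \<bar>spin_sum n \<omega>\<bar> \<ge> real (L k)}"
      unfolding n_def using m WV pos(1)[of k]
      by (intro prob_long_block) (simp add: \<kappa> field_simps)
    also have "\<dots> \<le> P.prob {\<omega>. \<bar>spin_sum n \<omega> / sqrt (real n)\<bar> > K}"
      by (intro P.finite_measure_mono meas) (use big in auto)
    finally show "\<exists>n\<in>{1..}. \<P>(\<omega> in P. \<bar>spin_sum n \<omega> / sqrt (real n)\<bar> > K) \<ge> W / V / 4"
      using \<open>m \<ge> 1\<close> by (intro bexI[of _ n]) (auto simp: n_def)
  qed

  have "integrable P (\<lambda>\<omega>. (spin (chain 1 \<omega>))\<^sup>2)"
  proof -
    have "(spin y)\<^sup>2 = 1" for y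
      by (simp add: spin_def)
    then show ?thesis by simp
  qed
  with stationary_ergodic_chain integral_spin_chain[of 1] summable not_bounded
  show ?thesis
    unfolding spin_sum_def[abs_def] Let_def
    by (intro exI[of _ P] exI[of _ "UNIV :: nat set"] exI[of _ chain] exI[of _ spin]) (simp del: chain.simps)
qed

end
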